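(* Let $(M,\omega,s)$ be a symplectic symmetric space. Then there exists one and only one admissible affine covariant derivative $\nabla$ on $M$ (called the canonical covariant derivative of $(M,\omega,s)$).
   Context: A symplectic symmetric space is a triple $(M,\omega,s)$ where $M$ is a connected $C^\infty$ manifold, $\omega$ is a symplectic form on $M$, and $s:M\times M\to M$, $s(x,y)=s_x(y)$, is a $C^\infty$ map such that: (i) for every $x\in M$, $s_x$ is an involutive symplectic diffeomorphism of $(M,\omega)$ (the symmetry at $x$); (ii) for every $x\in M$, $x$ is an isolated fixed point of $s_x$; (iii) $s_xs_ys_x=s_{s_x(y)}$ for all $x,y\in M$. An affine covariant derivative (linear connection on $TM$) $\nabla$ on $M$ is called admissible if (i) $\nabla\omega=0$ and (ii) for every $x\in M$, $s_x$ is an affine transformation of $(M,\nabla)$. (No condition on torsion is imposed in the definition.) *)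

theory Defs
  imports "HOL-Analysis.Analysis"
begin

section \<open>Smooth maps between open subsets of vector spaces\<close>

text \<open>
  \<open>Ck_on k f S\<close> says that \<open>f\<close> is of class \<open>C\<^sup>k\<close> on the open set \<open>S\<close>.
  Differentiability is total (Frechet) differentiability, and the recursion runs over the directional
  derivatives.  On a finite-dimensional domain, the only case used below, this is the usual notion.
\<close>

primrec Ck_on ::
  "nat \<Rightarrow> ('a::real_normed_vector \<Rightarrow> 'b::real_normed_vector) \<Rightarrow> 'a set \<Rightarrow> bool" where
  "Ck_on 0 f S \<longleftrightarrow> continuous_on S f"
| "Ck_on (Suc k) f S \<longleftrightarrow>
     (\<forall>x\<in>S. f differentiable (at x)) \<and>
     (\<forall>v. Ck_on k (\<lambda>x. frechet_derivative f (at x) v) S)"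

definition smooth_on :: "('a::real_normed_vector \<Rightarrow> 'b::real_normed_vector) \<Rightarrow> 'a set \<Rightarrow> bool" where
  "smooth_on f S \<longleftrightarrow> (\<forall>k. Ck_on k f S)"


section \<open>Smooth manifolds\<close>

text \<open>
  The underlying set of a manifold is a whole type \<open>'m\<close>.  A chart is a domain together with a map
  into the model space \<open>'e\<close>; only the values of the map on the domain matter.
\<close>

type_synonym ('m, 'e) chart = "'m set \<times> ('m \<Rightarrow> 'e)"

abbreviation cdom :: "('m, 'e) chart \<Rightarrow> 'm set" where "cdom \<equiv> fst"

abbreviation cmap :: "('m, 'e) chart \<Rightarrow> 'm \<Rightarrow> 'e" where "cmap \<equiv> snd"

abbreviation cimg :: "('m, 'e) chart \<Rightarrow> 'e set" where "cimg c \<equiv> cmap c ` cdom c"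

abbreviation cinv :: "('m, 'e) chart \<Rightarrow> 'e \<Rightarrow> 'm" where "cinv c \<equiv> inv_into (cdom c) (cmap c)"

definition is_chart :: "('m::topological_space, 'e::topological_space) chart \<Rightarrow> bool" where
  "is_chart c \<longleftrightarrow>
     open (cdom c) \<and> open (cimg c) \<and> homeomorphism (cdom c) (cimg c) (cmap c) (cinv c)"

definition smooth_atlas :: "('m::topological_space, 'e::real_normed_vector) chart set \<Rightarrow> bool" where
  "smooth_atlas A \<longleftrightarrow>
     (\<forall>c\<in>A. is_chart c) \<and> (\<Union>c\<in>A. cdom c) = UNIV \<and>
     (\<forall>c\<in>A. \<forall>d\<in>A. smooth_on (cmap d \<circ> cinv c) (cmap c ` (cdom c \<inter> cdom d)))"

text \<open>
  The model space is an arbitrary finite-dimensional real inner product space.  Class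
  \<open>euclidean_space\<close> is not used because it excludes the zero space, and with it manifolds of
  dimension 0.  Completeness (class \<open>banach\<close>) is automatic in finite dimension.  The atlas is not
  required to be maximal: any atlas determines the smooth structure.
\<close>

definition connected_manifold ::
  "('m::{t2_space,second_countable_topology}, 'e::{real_inner,banach}) chart set \<Rightarrow> bool" where
  "connected_manifold A \<longleftrightarrow>
     (\<exists>B::'e set. finite B \<and> span B = UNIV) \<and> smooth_atlas A \<and> connected (UNIV :: 'm set)"

definition prod_atlas ::
  "('m, 'e) chart set \<Rightarrow> ('n, 'f) chart set \<Rightarrow> ('m \<times> 'n, 'e \<times> 'f) chart set" where
  "prod_atlas A B = {(cdom c \<times> cdom d, map_prod (cmap c) (cmap d)) | c d. c \<in> A \<and> d \<in> B}"

definition smooth_map ::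
  "('m::topological_space, 'e::real_normed_vector) chart set \<Rightarrow>
   ('n::topological_space, 'f::real_normed_vector) chart set \<Rightarrow> ('m \<Rightarrow> 'n) \<Rightarrow> bool" where
  "smooth_map A B f \<longleftrightarrow>
     continuous_on UNIV f \<and>
     (\<forall>c\<in>A. \<forall>d\<in>B. smooth_on (cmap d \<circ> f \<circ> cinv c) (cmap c ` (cdom c \<inter> f -` cdom d)))"

definition smooth_functions ::
  "('m::topological_space, 'e::real_normed_vector) chart set \<Rightarrow> ('m \<Rightarrow> real) set" where
  "smooth_functions A = {f. smooth_map A {(UNIV, \<lambda>t::real. t)} f}"

definition diffeomorphism ::
  "('m::topological_space, 'e::real_normed_vector) chart set \<Rightarrow>
   ('n::topological_space, 'f::real_normed_vector) chart set \<Rightarrow> ('m \<Rightarrow> 'n) \<Rightarrow> bool" where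
  "diffeomorphism A B f \<longleftrightarrow> bij f \<and> smooth_map A B f \<and> smooth_map B A (inv f)"


section \<open>Tangent vectors and vector fields\<close>

text \<open>
  A tangent vector at \<open>p\<close> is a family of vectors of the model space, one for each chart around \<open>p\<close>,
  related by the derivatives of the coordinate changes.  At the charts not containing \<open>p\<close> the family
  is set to 0, so that equality of tangent vectors is equality of functions.
\<close>

type_synonym ('m, 'e) tvec = "('m, 'e) chart \<Rightarrow> 'e"

type_synonym ('m, 'e) vfield = "'m \<Rightarrow> ('m, 'e) tvec"

definition charts_at :: "('m, 'e) chart set \<Rightarrow> 'm \<Rightarrow> ('m, 'e) chart set" where
  "charts_at A p = {c \<in> A. p \<in> cdom c}"

definition some_chart :: "('m, 'e) chart set \<Rightarrow> 'm \<Rightarrow> ('m, 'e) chart" where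
  "some_chart A p = (SOME c. c \<in> charts_at A p)"

definition tangent_space ::
  "('m, 'e::real_normed_vector) chart set \<Rightarrow> 'm \<Rightarrow> ('m, 'e) tvec set" where
  "tangent_space A p =
     {v. (\<forall>c. c \<notin> charts_at A p \<longrightarrow> v c = 0) \<and>
         (\<forall>c\<in>charts_at A p. \<forall>d\<in>charts_at A p.
            v d = frechet_derivative (cmap d \<circ> cinv c) (at (cmap c p)) (v c))}"

text \<open>The tangent vector at \<open>p\<close> whose representative in the chart \<open>c\<close> is \<open>u\<close>.\<close>

definition coord_vec ::
  "('m, 'e::real_normed_vector) chart set \<Rightarrow> ('m, 'e) chart \<Rightarrow> 'm \<Rightarrow> 'e \<Rightarrow> ('m, 'e) tvec" where
  "coord_vec A c p u =
     (\<lambda>d. if d \<in> charts_at A p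
          then frechet_derivative (cmap d \<circ> cinv c) (at (cmap c p)) u else 0)"

definition vector_fields ::
  "('m, 'e::real_normed_vector) chart set \<Rightarrow> ('m, 'e) vfield set" where
  "vector_fields A =
     {X. (\<forall>p. X p \<in> tangent_space A p) \<and> (\<forall>c\<in>A. smooth_on (\<lambda>y. X (cinv c y) c) (cimg c))}"

definition vf_add ::
  "('m, 'e::real_normed_vector) vfield \<Rightarrow> ('m, 'e) vfield \<Rightarrow> ('m, 'e) vfield" where
  "vf_add X Y = (\<lambda>p c. X p c + Y p c)"

definition vf_scale ::
  "('m \<Rightarrow> real) \<Rightarrow> ('m, 'e::real_normed_vector) vfield \<Rightarrow> ('m, 'e) vfield" where
  "vf_scale f X = (\<lambda>p c. f p *\<^sub>R X p c)"

text \<open>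
  The derivative \<open>X f\<close> of a function along a vector field, and the differential of a map.  Neither
  depends on the chart used, by the compatibility of the representatives of a tangent vector.
\<close>

definition vf_deriv ::
  "('m, 'e::real_normed_vector) chart set \<Rightarrow> ('m, 'e) vfield \<Rightarrow> ('m \<Rightarrow> real) \<Rightarrow> 'm \<Rightarrow> real" where
  "vf_deriv A X f p =
     (let c = some_chart A p in frechet_derivative (f \<circ> cinv c) (at (cmap c p)) (X p c))"

definition differential ::
  "('m, 'e::real_normed_vector) chart set \<Rightarrow> ('n, 'f::real_normed_vector) chart set \<Rightarrow>
   ('m \<Rightarrow> 'n) \<Rightarrow> 'm \<Rightarrow> ('m, 'e) tvec \<Rightarrow> ('n, 'f) tvec" where
  "differential A B f p v =
     (let c = some_chart A p in
        (\<lambda>d. if d \<in> charts_at B (f p)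
             then frechet_derivative (cmap d \<circ> f \<circ> cinv c) (at (cmap c p)) (v c) else 0))"

definition vf_push ::
  "('m, 'e::real_normed_vector) chart set \<Rightarrow> ('m \<Rightarrow> 'm) \<Rightarrow> ('m, 'e) vfield \<Rightarrow> ('m, 'e) vfield" where
  "vf_push A f X = (\<lambda>p. differential A A f (inv f p) (X (inv f p)))"


section \<open>Symplectic forms\<close>

type_synonym ('m, 'e) form2 = "'m \<Rightarrow> ('m, 'e) tvec \<Rightarrow> ('m, 'e) tvec \<Rightarrow> real"

text \<open>The coefficients of a 2-form in the chart \<open>c\<close>, as a function on the image of the chart.\<close>

definition form2_coeff ::
  "('m, 'e::real_normed_vector) chart set \<Rightarrow> ('m, 'e) form2 \<Rightarrow> ('m, 'e) chart \<Rightarrow>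
   'e \<Rightarrow> 'e \<Rightarrow> 'e \<Rightarrow> real" where
  "form2_coeff A \<omega> c u v y =
     \<omega> (cinv c y) (coord_vec A c (cinv c y) u) (coord_vec A c (cinv c y) v)"

definition is_form2 ::
  "('m, 'e::real_normed_vector) chart set \<Rightarrow> ('m, 'e) form2 \<Rightarrow> bool" where
  "is_form2 A \<omega> \<longleftrightarrow>
     (\<forall>p. \<forall>u\<in>tangent_space A p. \<forall>v\<in>tangent_space A p. \<forall>w\<in>tangent_space A p. \<forall>a b.
        \<omega> p (\<lambda>c. a *\<^sub>R u c + b *\<^sub>R v c) w = a * \<omega> p u w + b * \<omega> p v w) \<and>
     (\<forall>p. \<forall>u\<in>tangent_space A p. \<forall>v\<in>tangent_space A p. \<omega> p u v = - \<omega> p v u) \<and>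
     (\<forall>c\<in>A. \<forall>u v. smooth_on (form2_coeff A \<omega> c u v) (cimg c))"

text \<open>
  \<open>d\<omega> (u, v, w)\<close> at the point with coordinate \<open>y\<close>, evaluated on the constant coordinate fields
  \<open>u\<close>, \<open>v\<close>, \<open>w\<close> of the chart \<open>c\<close>.
\<close>

definition ext_deriv2 ::
  "('m, 'e::real_normed_vector) chart set \<Rightarrow> ('m, 'e) form2 \<Rightarrow> ('m, 'e) chart \<Rightarrow>
   'e \<Rightarrow> 'e \<Rightarrow> 'e \<Rightarrow> 'e \<Rightarrow> real" where
  "ext_deriv2 A \<omega> c u v w y =
     frechet_derivative (form2_coeff A \<omega> c v w) (at y) u
   - frechet_derivative (form2_coeff A \<omega> c u w) (at y) v
   + frechet_derivative (form2_coeff A \<omega> c u v) (at y) w"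

definition symplectic_form ::
  "('m, 'e::real_normed_vector) chart set \<Rightarrow> ('m, 'e) form2 \<Rightarrow> bool" where
  "symplectic_form A \<omega> \<longleftrightarrow>
     is_form2 A \<omega> \<and>
     (\<forall>c\<in>A. \<forall>y\<in>cimg c. \<forall>u v w. ext_deriv2 A \<omega> c u v w y = 0) \<and>
     (\<forall>p. \<forall>v\<in>tangent_space A p. (\<forall>w\<in>tangent_space A p. \<omega> p v w = 0) \<longrightarrow> v = (\<lambda>c. 0))"

definition symplectic_diffeomorphism ::
  "('m::topological_space, 'e::real_normed_vector) chart set \<Rightarrow> ('m, 'e) form2 \<Rightarrow>
   ('m \<Rightarrow> 'm) \<Rightarrow> bool" where
  "symplectic_diffeomorphism A \<omega> f \<longleftrightarrow>
     diffeomorphism A A f \<and>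
     (\<forall>p. \<forall>v\<in>tangent_space A p. \<forall>w\<in>tangent_space A p.
        \<omega> (f p) (differential A A f p v) (differential A A f p w) = \<omega> p v w)"


section \<open>Symplectic symmetric spaces\<close>

definition symplectic_symmetric_space ::
  "('m::{t2_space,second_countable_topology}, 'e::{real_inner,banach}) chart set \<Rightarrow>
   ('m, 'e) form2 \<Rightarrow> ('m \<Rightarrow> 'm \<Rightarrow> 'm) \<Rightarrow> bool" where
  "symplectic_symmetric_space A \<omega> s \<longleftrightarrow>
     connected_manifold A \<and> symplectic_form A \<omega> \<and>
     smooth_map (prod_atlas A A) A (\<lambda>(x, y). s x y) \<and>
     (\<forall>x. s x \<circ> s x = id \<and> symplectic_diffeomorphism A \<omega> (s x)) \<and>
     (\<forall>x. x isolated_in {y. s x y = y}) \<and>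
     (\<forall>x y. s x \<circ> s y \<circ> s x = s (s x y))"


section \<open>Covariant derivatives\<close>

text \<open>
  An affine covariant derivative is an operator on pairs of smooth vector fields.  As elements of the
  extensional function space, two of them are equal iff they agree on all smooth vector fields.
  Homogeneity over the reals in the second argument is the Leibniz rule for constant functions.
\<close>

definition covariant_derivative ::
  "('m::topological_space, 'e::real_normed_vector) chart set \<Rightarrow>
   (('m, 'e) vfield \<times> ('m, 'e) vfield \<Rightarrow> ('m, 'e) vfield) \<Rightarrow> bool" where
  "covariant_derivative A nabla \<longleftrightarrow>
     nabla \<in> (vector_fields A \<times> vector_fields A) \<rightarrow>\<^sub>E vector_fields A \<and>
     (\<forall>X\<in>vector_fields A. \<forall>Y\<in>vector_fields A. \<forall>Z\<in>vector_fields A.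
        nabla (vf_add X Y, Z) = vf_add (nabla (X, Z)) (nabla (Y, Z)) \<and>
        nabla (X, vf_add Y Z) = vf_add (nabla (X, Y)) (nabla (X, Z))) \<and>
     (\<forall>f\<in>smooth_functions A. \<forall>X\<in>vector_fields A. \<forall>Y\<in>vector_fields A.
        nabla (vf_scale f X, Y) = vf_scale f (nabla (X, Y)) \<and>
        nabla (X, vf_scale f Y) = vf_add (vf_scale (vf_deriv A X f) Y) (vf_scale f (nabla (X, Y))))"

definition nabla_form2 ::
  "('m, 'e::real_normed_vector) chart set \<Rightarrow>
   (('m, 'e) vfield \<times> ('m, 'e) vfield \<Rightarrow> ('m, 'e) vfield) \<Rightarrow> ('m, 'e) form2 \<Rightarrow>
   ('m, 'e) vfield \<Rightarrow> ('m, 'e) vfield \<Rightarrow> ('m, 'e) vfield \<Rightarrow> 'm \<Rightarrow> real" where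
  "nabla_form2 A nabla \<omega> X Y Z p =
     vf_deriv A X (\<lambda>q. \<omega> q (Y q) (Z q)) p
   - \<omega> p (nabla (X, Y) p) (Z p) - \<omega> p (Y p) (nabla (X, Z) p)"

definition affine_transformation ::
  "('m::topological_space, 'e::real_normed_vector) chart set \<Rightarrow>
   (('m, 'e) vfield \<times> ('m, 'e) vfield \<Rightarrow> ('m, 'e) vfield) \<Rightarrow> ('m \<Rightarrow> 'm) \<Rightarrow> bool" where
  "affine_transformation A nabla f \<longleftrightarrow>
     diffeomorphism A A f \<and>
     (\<forall>X\<in>vector_fields A. \<forall>Y\<in>vector_fields A.
        vf_push A f (nabla (X, Y)) = nabla (vf_push A f X, vf_push A f Y))"

definition admissible ::
  "('m::topological_space, 'e::real_normed_vector) chart set \<Rightarrow> ('m, 'e) form2 \<Rightarrow>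
   ('m \<Rightarrow> 'm \<Rightarrow> 'm) \<Rightarrow>
   (('m, 'e) vfield \<times> ('m, 'e) vfield \<Rightarrow> ('m, 'e) vfield) \<Rightarrow> bool" where
  "admissible A \<omega> s nabla \<longleftrightarrow>
     covariant_derivative A nabla \<and>
     (\<forall>X\<in>vector_fields A. \<forall>Y\<in>vector_fields A. \<forall>Z\<in>vector_fields A. \<forall>p.
        nabla_form2 A nabla \<omega> X Y Z p = 0) \<and>
     (\<forall>x. affine_transformation A nabla (s x))"

end

theory Submission
  imports Defs "HOL-Computational_Algebra.Polynomial"
begin

text \<open>
The differential of the symmetry \<open>s\<^sub>p\<close> at its centre \<open>p\<close> is \<open>-1\<close>.  Indeed \<open>s\<^sub>p\<close> is conjugate near \<open>p\<close>
to its linear part, because it is an involution; a nonzero vector fixed by that part would therefore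
give fixed points of \<open>s\<^sub>p\<close> arbitrarily near \<open>p\<close>, and \<open>p\<close> is isolated.  This is
\<open>involution_derivative_isolated_fixed_point\<close>, used through \<open>differential_sym\<close>.

It follows that for every vector field \<open>Y\<close> the field \<open>Y + (s\<^sub>p)\<^sub>* Y\<close> vanishes at \<open>p\<close>.  The derivative
\<open>D W\<close> of a vector field \<open>W\<close> at a zero is an endomorphism of the tangent space that needs no
connection: it is the Jacobian in any chart, and it is natural under diffeomorphisms
(\<open>zero_deriv_push\<close>).  It is also what every covariant derivative of \<open>W\<close> yields at such a point.
Both halves of the theorem come from the formula
   \<open>(\<nabla>\<^sub>X Y)(p) = 1/2 D\<^bsub>X(p)\<^esub> (Y + (s\<^sub>p)\<^sub>* Y)\<close>.

Uniqueness.  If \<open>s\<^sub>p\<close> is affine for \<open>\<nabla>\<close>, then at \<open>p\<close>, where \<open>(s\<^sub>p)\<^sub>*\<close> is \<open>-1\<close>,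
   \<open>- \<nabla>\<^sub>X Y = (s\<^sub>p)\<^sub>* (\<nabla>\<^sub>X Y) = \<nabla>\<^bsub>(s\<^sub>p)\<^sub>* X\<^esub> ((s\<^sub>p)\<^sub>* Y) = - \<nabla>\<^sub>X ((s\<^sub>p)\<^sub>* Y)\<close>.
So \<open>2 \<nabla>\<^sub>X Y = \<nabla>\<^sub>X (Y + (s\<^sub>p)\<^sub>* Y)\<close> at \<open>p\<close>, and the right-hand side does not depend on \<open>\<nabla>\<close>
(\<open>admissible_sym_sum\<close>, \<open>covariant_derivative_agree_at_zero\<close>).  Since a covariant derivative acts on
global fields, the evaluation at a point rests on cut-off functions (\<open>tensorial_vanishes\<close>).

Existence.  Take the formula as the definition.  The Leibniz rule holds because the derivative of
\<open>f \<circ> s\<^sub>p\<close> at \<open>p\<close> is the negative of that of \<open>f\<close>; smoothness in \<open>p\<close> is the joint smoothness of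
\<open>(x, y) \<mapsto> s\<^sub>x y\<close>; invariance under \<open>s\<^sub>x\<close> follows from \<open>s\<^sub>x s\<^sub>p = s\<^bsub>s\<^sub>x p\<^esub> s\<^sub>x\<close> and
naturality.  Finally, let \<open>Y' = (s\<^sub>p)\<^sub>* Y\<close>, \<open>Z' = (s\<^sub>p)\<^sub>* Z\<close> and \<open>g = \<omega>(Y, Z)\<close>.  As \<open>s\<^sub>p\<close> preserves \<open>\<omega>\<close>,
   \<open>g - g \<circ> s\<^sub>p = \<omega>(Y, Z) - \<omega>(Y', Z') = \<omega>(Y + Y', Z) - \<omega>(Y', Z + Z')\<close>,
and the derivative of this identity at \<open>p\<close> is twice the equation \<open>\<nabla>\<omega> = 0\<close> (\<open>canonical_nabla_form\<close>).
\<close>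


section \<open>Calculus of smooth maps on finite-dimensional spaces\<close>

text \<open>
The form in which finite dimension is used: an orthonormal basis is such a frame, and expanding a
linear map along it reduces statements about derivatives to directional derivatives.
\<close>

definition parseval_frame :: "'a::real_inner set \<Rightarrow> bool" where
  "parseval_frame B \<longleftrightarrow> finite B \<and> (\<forall>x. (\<Sum>e\<in>B. (x \<bullet> e) *\<^sub>R e) = x)"

text \<open>
Gram--Schmidt turns a finite spanning set into an orthogonal one; its nonzero members, normalised,
satisfy the expansion on each basis vector and hence on the span.
\<close>

lemma parseval_frame_exists:
  fixes B :: "'a::real_inner set"
  assumes "finite B" "span B = UNIV"
  shows "\<exists>C::'a set. parseval_frame C"
proof -
  obtain C where C: "finite C" "span C = span B" "pairwise orthogonal C"
    using basis_orthogonal[OF assms(1)] by blast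
  define D where "D = (\<lambda>x. x /\<^sub>R norm x) ` (C - {0})"
  have finD: "finite D" using C(1) by (simp add: D_def)
  have unit: "e \<bullet> e = 1" if e: "e \<in> D" for e
  proof -
    obtain x where "x \<noteq> 0" "e = x /\<^sub>R norm x" using e by (auto simp: D_def)
    then have "norm e = 1" by simp
    then show ?thesis by (simp add: dot_square_norm)
  qed
  have orth: "e \<bullet> e' = 0" if "e \<in> D" "e' \<in> D" "e \<noteq> e'" for e e'
    using that C(3) unfolding D_def pairwise_def orthogonal_def by fastforce
  have "C \<subseteq> span D"
  proof
    fix x assume x: "x \<in> C"
    show "x \<in> span D"
    proof (cases "x = 0")
      case False
      then have "x /\<^sub>R norm x \<in> span D"
        using x by (intro span_base) (auto simp: D_def)
      then have "norm x *\<^sub>R (x /\<^sub>R norm x) \<in> span D" by (rule span_scale)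
      then show ?thesis using False by simp
    qed (simp add: span_zero)
  qed
  then have spanD: "span D = UNIV"
    using C(2) assms(2) by (metis span_mono span_span top.extremum_uniqueI)
  have "(\<Sum>e\<in>D. (x \<bullet> e) *\<^sub>R e) = x" for x
  proof -
    have "x \<in> span D" using spanD by simp
    then show ?thesis
    proof (induction rule: span_induct_alt)
      case base
      show ?case by simp
    next
      case (step c d y)
      have "(\<Sum>e\<in>D. (d \<bullet> e) *\<^sub>R e) = (\<Sum>e\<in>D. if e = d then d else 0)"
        using step(1) by (intro sum.cong) (auto simp: unit orth)
      also have "\<dots> = d" using step(1) finD by simp
      finally have d: "(\<Sum>e\<in>D. (d \<bullet> e) *\<^sub>R e) = d" .
      have "(\<Sum>e\<in>D. ((c *\<^sub>R d + y) \<bullet> e) *\<^sub>R e)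
          = c *\<^sub>R (\<Sum>e\<in>D. (d \<bullet> e) *\<^sub>R e) + (\<Sum>e\<in>D. (y \<bullet> e) *\<^sub>R e)"
        by (simp add: inner_add_left scaleR_add_left sum.distrib scaleR_sum_right)
      then show ?case using d step by simp
    qed
  qed
  then show ?thesis using finD by (auto simp: parseval_frame_def)
qed

lemma parseval_frame_Times:
  fixes B :: "'a::real_inner set" and C :: "'b::real_inner set"
  assumes "parseval_frame B" "parseval_frame C"
  shows "\<exists>D::('a \<times> 'b) set. parseval_frame D"
proof -
  let ?B = "(\<lambda>e. (e, 0::'b)) ` (B - {0})" and ?C = "(\<lambda>e. (0::'a, e)) ` (C - {0})"
  have fin: "finite B" "finite C" using assms by (auto simp: parseval_frame_def)
  have disj: "?B \<inter> ?C = {}" by auto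
  have "(\<Sum>e\<in>?B \<union> ?C. (x \<bullet> e) *\<^sub>R e) = x" for x :: "'a \<times> 'b"
  proof -
    have "(\<Sum>e\<in>?B. (x \<bullet> e) *\<^sub>R e) = (\<Sum>e\<in>B - {0}. ((fst x \<bullet> e) *\<^sub>R e, 0))"
      by (subst sum.reindex) (auto simp: inj_on_def inner_prod_def)
    also have "\<dots> = (\<Sum>e\<in>B. ((fst x \<bullet> e) *\<^sub>R e, 0))"
      using fin by (intro sum.mono_neutral_left) (auto simp: zero_prod_def)
    also have "\<dots> = (\<Sum>e\<in>B. (fst x \<bullet> e) *\<^sub>R e, 0)"
      by (simp add: sum_prod)
    finally have 1: "(\<Sum>e\<in>?B. (x \<bullet> e) *\<^sub>R e) = (fst x, 0)"
      using assms(1) by (simp add: parseval_frame_def)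
    have "(\<Sum>e\<in>?C. (x \<bullet> e) *\<^sub>R e) = (\<Sum>e\<in>C - {0}. (0, (snd x \<bullet> e) *\<^sub>R e))"
      by (subst sum.reindex) (auto simp: inj_on_def inner_prod_def)
    also have "\<dots> = (\<Sum>e\<in>C. (0, (snd x \<bullet> e) *\<^sub>R e))"
      using fin by (intro sum.mono_neutral_left) (auto simp: zero_prod_def)
    also have "\<dots> = (0, \<Sum>e\<in>C. (snd x \<bullet> e) *\<^sub>R e)"
      by (simp add: sum_prod)
    finally have 2: "(\<Sum>e\<in>?C. (x \<bullet> e) *\<^sub>R e) = (0, snd x)"
      using assms(2) by (simp add: parseval_frame_def)
    show ?thesis using fin disj by (subst sum.union_disjoint) (auto simp: 1 2)
  qed
  then show ?thesis using fin by (intro exI[of _ "?B \<union> ?C"]) (auto simp: parseval_frame_def)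
qed

lemma parseval_frame_real: "parseval_frame {1::real}"
  by (simp add: parseval_frame_def)

lemma linear_parseval_frame:
  assumes "parseval_frame B" "linear L"
  shows "L v = (\<Sum>e\<in>B. (v \<bullet> e) *\<^sub>R L e)"
proof -
  have "L v = L (\<Sum>e\<in>B. (v \<bullet> e) *\<^sub>R e)" using assms(1) by (simp add: parseval_frame_def)
  then show ?thesis by (simp add: linear_sum[OF assms(2)] linear_scale[OF assms(2)])
qed

text \<open>
The ball about 0 lies in the compact set of combinations \<open>\<Sum>e\<in>B. t e *\<^sub>R e\<close> with bounded coefficients,
by Cauchy--Schwarz; compactness of that set follows by adding one direction at a time.
\<close>

lemma compact_cball_parseval_frame:
  fixes B :: "'a::real_inner set"
  assumes "parseval_frame B"
  shows "compact (cball (y::'a) r)"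
proof -
  have fin: "finite B" using assms by (simp add: parseval_frame_def)
  define K where "K = (\<lambda>F::'a set. {(\<Sum>e\<in>F. t e *\<^sub>R e) |t. \<forall>e\<in>F. \<bar>t e\<bar> \<le> r * norm e})"
  have "compact (K F)" if "finite F" for F
    using that
  proof induction
    case empty
    show ?case by (simp add: K_def)
  next
    case (insert e F)
    let ?I = "(\<lambda>t. t *\<^sub>R e) ` {- r * norm e .. r * norm e}"
    have "K (insert e F) = {x + y |x y. x \<in> ?I \<and> y \<in> K F}" (is "_ = ?R")
    proof (intro equalityI subsetI)
      fix z assume "z \<in> K (insert e F)"
      then obtain t where t: "z = (\<Sum>e\<in>insert e F. t e *\<^sub>R e)" "\<forall>e\<in>insert e F. \<bar>t e\<bar> \<le> r * norm e"
        by (auto simp: K_def)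
      have "z = t e *\<^sub>R e + (\<Sum>e\<in>F. t e *\<^sub>R e)" using insert t by simp
      moreover have "t e *\<^sub>R e \<in> ?I" using t by (auto simp: abs_le_iff)
      moreover have "(\<Sum>e\<in>F. t e *\<^sub>R e) \<in> K F" using t by (auto simp: K_def)
      ultimately show "z \<in> ?R" by blast
    next
      fix z assume "z \<in> ?R"
      then obtain x y where xy: "z = x + y" "x \<in> ?I" "y \<in> K F" by blast
      obtain a where "a \<in> {- r * norm e .. r * norm e}" and x: "x = a *\<^sub>R e" using xy(2) by blast
      then have a: "\<bar>a\<bar> \<le> r * norm e" by (simp add: abs_le_iff)
      obtain t where t: "\<forall>e\<in>F. \<bar>t e\<bar> \<le> r * norm e" "y = (\<Sum>e\<in>F. t e *\<^sub>R e)"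
        using xy(3) unfolding K_def by blast
      have "(\<Sum>x\<in>F. (t(e := a)) x *\<^sub>R x) = (\<Sum>x\<in>F. t x *\<^sub>R x)"
        using insert by (intro sum.cong) auto
      then have "z = (\<Sum>x\<in>insert e F. (t(e := a)) x *\<^sub>R x)"
        using insert xy(1) x t(2) by simp
      moreover have "\<forall>x\<in>insert e F. \<bar>(t(e := a)) x\<bar> \<le> r * norm x" using a t(1) by simp
      ultimately show "z \<in> K (insert e F)" unfolding K_def by blast
    qed
    moreover have "compact ?I" by (intro compact_continuous_image continuous_intros compact_Icc)
    ultimately show ?case using insert by (simp add: compact_sums)
  qed
  then have "compact (K B)" using fin by simp
  moreover have "cball 0 r \<subseteq> K B"
  proof
    fix x assume x: "x \<in> cball (0::'a) r"
    have "\<bar>x \<bullet> e\<bar> \<le> r * norm e" for e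
      using Cauchy_Schwarz_ineq2[of x e] x
      by (meson mem_cball_0 mult_right_mono norm_ge_zero order_trans)
    moreover have "x = (\<Sum>e\<in>B. (x \<bullet> e) *\<^sub>R e)" using assms by (simp add: parseval_frame_def)
    ultimately show "x \<in> K B" by (auto simp: K_def)
  qed
  ultimately have "compact (cball (0::'a) r)" by (metis closed_cball compact_Int_closed inf.absorb_iff2)
  then have "compact ((+) y ` cball 0 r)" by (rule compact_translation)
  then show ?thesis by (simp add: image_add_cball)
qed


subsection \<open>Closure properties of smooth maps\<close>

lemma has_derivative_frechet:
  "f differentiable (at x) \<Longrightarrow> (f has_derivative frechet_derivative f (at x)) (at x)"
  by (simp add: frechet_derivative_works)

lemma frechet_derivative_eqI:
  "(f has_derivative f') (at x) \<Longrightarrow> frechet_derivative f (at x) = f'"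
  by (metis frechet_derivative_at)

lemma Ck_on_cong:
  assumes "open S" "\<And>x. x \<in> S \<Longrightarrow> f x = g x" "Ck_on k f S"
  shows "Ck_on k g S"
  using assms
proof (induction k arbitrary: f g)
  case 0
  then show ?case using continuous_on_cong[of S S f g] by simp
next
  case (Suc k)
  have d: "(g has_derivative frechet_derivative f (at x)) (at x)" if "x \<in> S" for x
    using Suc.prems that
    by (auto intro!: has_derivative_transform_within_open[OF has_derivative_frechet Suc.prems(1)])
  have "Ck_on k (\<lambda>x. frechet_derivative g (at x) v) S" for v
  proof (rule Suc.IH[OF Suc.prems(1)])
    show "Ck_on k (\<lambda>x. frechet_derivative f (at x) v) S" using Suc.prems(3) by simp
  qed (simp add: frechet_derivative_eqI[OF d])
  then show ?case using d by (auto simp: differentiable_def)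
qed

lemma smooth_on_cong:
  assumes "smooth_on f S" "open S" "\<And>x. x \<in> S \<Longrightarrow> f x = g x"
  shows "smooth_on g S"
  using assms Ck_on_cong unfolding smooth_on_def by blast

lemma Ck_on_SucD: "Ck_on (Suc k) f S \<Longrightarrow> Ck_on k f S"
proof (induction k arbitrary: f)
  case 0
  then have "isCont f x" if "x \<in> S" for x
    using that differentiable_imp_continuous_within[of f x UNIV] by simp
  then show ?case by (simp add: continuous_at_imp_continuous_on)
next
  case (Suc k)
  then show ?case by (metis Ck_on.simps(2))
qed

lemma Ck_on_subset: "Ck_on k f S \<Longrightarrow> T \<subseteq> S \<Longrightarrow> Ck_on k f T"
  by (induction k arbitrary: f) (auto intro: continuous_on_subset)

lemma smooth_on_subset: "smooth_on f S \<Longrightarrow> T \<subseteq> S \<Longrightarrow> smooth_on f T"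
  unfolding smooth_on_def using Ck_on_subset by blast

lemma smooth_on_differentiable: "smooth_on f S \<Longrightarrow> x \<in> S \<Longrightarrow> f differentiable (at x)"
  unfolding smooth_on_def by (metis Ck_on.simps(2))

lemma smooth_on_has_derivative:
  "smooth_on f S \<Longrightarrow> x \<in> S \<Longrightarrow> (f has_derivative frechet_derivative f (at x)) (at x)"
  by (simp add: smooth_on_differentiable has_derivative_frechet)

lemma smooth_on_continuous: "smooth_on f S \<Longrightarrow> continuous_on S f"
  unfolding smooth_on_def by (metis Ck_on.simps(1))

lemma smooth_on_frechet: "smooth_on f S \<Longrightarrow> smooth_on (\<lambda>x. frechet_derivative f (at x) v) S"
  unfolding smooth_on_def by (metis Ck_on.simps(2))

lemma Ck_on_local:
  assumes "\<And>x. x \<in> S \<Longrightarrow> \<exists>T. open T \<and> x \<in> T \<and> Ck_on k f T"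
  shows "Ck_on k f S"
  using assms
proof (induction k arbitrary: f)
  case 0
  have "isCont f x" if "x \<in> S" for x
    using 0[OF that] continuous_on_eq_continuous_at by auto
  then show ?case by (simp add: continuous_at_imp_continuous_on)
next
  case (Suc k)
  show ?case
    unfolding Ck_on.simps
  proof (intro conjI ballI allI)
    show "f differentiable (at x)" if "x \<in> S" for x using Suc.prems[OF that] by auto
    show "Ck_on k (\<lambda>x. frechet_derivative f (at x) v) S" for v
      using Suc.prems by (intro Suc.IH) fastforce
  qed
qed

lemma smooth_on_local:
  assumes "\<And>x. x \<in> S \<Longrightarrow> \<exists>T. open T \<and> x \<in> T \<and> smooth_on f T"
  shows "smooth_on f S"
  using assms Ck_on_local unfolding smooth_on_def by meson

lemma Ck_on_const: "Ck_on k (\<lambda>x. c) S"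
  by (induction k arbitrary: c) auto

lemma smooth_on_const: "smooth_on (\<lambda>x. c) S"
  by (simp add: smooth_on_def Ck_on_const)

lemma Ck_on_bounded_linear: "bounded_linear f \<Longrightarrow> Ck_on k f S"
proof (cases k)
  case 0
  then show "bounded_linear f \<Longrightarrow> Ck_on k f S"
    by (simp add: linear_continuous_on)
next
  case (Suc j)
  assume f: "bounded_linear f"
  then have "frechet_derivative f (at x) = f" for x
    by (intro frechet_derivative_eqI bounded_linear_imp_has_derivative)
  then show "Ck_on k f S"
    using f Suc by (auto simp: Ck_on_const bounded_linear_imp_differentiable)
qed

lemma smooth_on_bounded_linear: "bounded_linear f \<Longrightarrow> smooth_on f S"
  by (simp add: smooth_on_def Ck_on_bounded_linear)

lemma smooth_on_ident: "smooth_on (\<lambda>x. x) S"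
  by (intro smooth_on_bounded_linear bounded_linear_ident)

lemma Ck_on_add:
  assumes "open S" "Ck_on k f S" "Ck_on k g S"
  shows "Ck_on k (\<lambda>x. f x + g x) S"
  using assms
proof (induction k arbitrary: f g)
  case 0
  then show ?case by (simp add: continuous_on_add)
next
  case (Suc k)
  have d: "((\<lambda>x. f x + g x) has_derivative
      (\<lambda>v. frechet_derivative f (at x) v + frechet_derivative g (at x) v)) (at x)" if "x \<in> S" for x
    using Suc.prems that by (auto intro!: has_derivative_add has_derivative_frechet)
  have "Ck_on k (\<lambda>x. frechet_derivative (\<lambda>x. f x + g x) (at x) v) S" for v
  proof (rule Ck_on_cong[OF Suc.prems(1)])
    show "Ck_on k (\<lambda>x. frechet_derivative f (at x) v + frechet_derivative g (at x) v) S"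
      using Suc.prems by (simp add: Suc.IH)
  qed (simp add: frechet_derivative_eqI[OF d])
  then show ?case using d by (auto simp: differentiable_def)
qed

lemma smooth_on_add:
  "smooth_on f S \<Longrightarrow> smooth_on g S \<Longrightarrow> open S \<Longrightarrow> smooth_on (\<lambda>x. f x + g x) S"
  by (simp add: smooth_on_def Ck_on_add)

lemma Ck_on_sum:
  "(\<And>i. i \<in> I \<Longrightarrow> Ck_on k (f i) S) \<Longrightarrow> open S \<Longrightarrow> Ck_on k (\<lambda>x. \<Sum>i\<in>I. f i x) S"
  by (induction I rule: infinite_finite_induct) (auto simp: Ck_on_const Ck_on_add)

lemma smooth_on_sum:
  "(\<And>i. i \<in> I \<Longrightarrow> smooth_on (f i) S) \<Longrightarrow> open S \<Longrightarrow> smooth_on (\<lambda>x. \<Sum>i\<in>I. f i x) S"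
  by (simp add: smooth_on_def Ck_on_sum)

lemma (in bounded_bilinear) Ck_on_bilinear:
  assumes "open S" "Ck_on k f S" "Ck_on k g S"
  shows "Ck_on k (\<lambda>x. prod (f x) (g x)) S"
  using assms
proof (induction k arbitrary: f g)
  case 0
  then show ?case by (simp add: continuous_on)
next
  case (Suc k)
  have d: "((\<lambda>x. prod (f x) (g x)) has_derivative
      (\<lambda>v. prod (f x) (frechet_derivative g (at x) v) + prod (frechet_derivative f (at x) v) (g x)))
      (at x)" if "x \<in> S" for x
    using Suc.prems that by (auto intro!: FDERIV has_derivative_frechet)
  have "Ck_on k (\<lambda>x. frechet_derivative (\<lambda>x. prod (f x) (g x)) (at x) v) S" for v
  proof (rule Ck_on_cong[OF Suc.prems(1)])
    show "Ck_on k (\<lambda>x. prod (f x) (frechet_derivative g (at x) v)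
        + prod (frechet_derivative f (at x) v) (g x)) S"
      using Suc.prems Ck_on_SucD[OF Suc.prems(2)] Ck_on_SucD[OF Suc.prems(3)]
      by (simp add: Ck_on_add Suc.IH)
  qed (simp add: frechet_derivative_eqI[OF d])
  then show ?case using d by (auto simp: differentiable_def)
qed

lemma (in bounded_bilinear) smooth_on_bilinear:
  "smooth_on f S \<Longrightarrow> smooth_on g S \<Longrightarrow> open S \<Longrightarrow> smooth_on (\<lambda>x. prod (f x) (g x)) S"
  by (simp add: smooth_on_def Ck_on_bilinear)

lemmas smooth_on_scaleR = bounded_bilinear.smooth_on_bilinear[OF bounded_bilinear_scaleR]
lemmas smooth_on_mult = bounded_bilinear.smooth_on_bilinear[OF bounded_bilinear_mult]
lemmas smooth_on_inner = bounded_bilinear.smooth_on_bilinear[OF bounded_bilinear_inner]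

text \<open>
The chain rule gives \<open>D(f \<circ> g)(x) v\<close> as \<open>D f\<close>, at a moving point, of a moving vector.  Expanding that
vector along a frame leaves products of \<open>C\<^sup>k\<close> coefficients with the functions \<open>(D f \<cdot> e) \<circ> g\<close>, to
which the induction hypothesis applies.
\<close>

lemma Ck_on_compose:
  fixes B :: "'b::real_inner set"
  assumes "parseval_frame B" "open S" "Ck_on k f T" "Ck_on k g S" "g ` S \<subseteq> T"
  shows "Ck_on k (\<lambda>x. f (g x :: 'b)) S"
  using assms
proof (induction k arbitrary: f)
  case 0
  then show ?case by (auto intro: continuous_on_compose2)
next
  case (Suc k)
  have T: "g x \<in> T" if "x \<in> S" for x using that Suc.prems by auto
  have d: "((\<lambda>x. f (g x)) has_derivative
      (\<lambda>v. frechet_derivative f (at (g x)) (frechet_derivative g (at x) v))) (at x)"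
    if "x \<in> S" for x
    using Suc.prems that T[OF that]
    by (intro has_derivative_compose[OF has_derivative_frechet has_derivative_frechet]) simp_all
  have eq: "(\<Sum>e\<in>B. (frechet_derivative g (at x) v \<bullet> e) *\<^sub>R frechet_derivative f (at (g x)) e)
      = frechet_derivative (\<lambda>x. f (g x)) (at x) v" if "x \<in> S" for x v
    unfolding frechet_derivative_eqI[OF d[OF that]]
    using Suc.prems(3) T[OF that]
    by (intro linear_parseval_frame[OF Suc.prems(1), symmetric] linear_frechet_derivative) simp
  have "Ck_on k (\<lambda>x. frechet_derivative (\<lambda>x. f (g x)) (at x) v) S" for v
  proof (rule Ck_on_cong[OF Suc.prems(2)])
    show "Ck_on k (\<lambda>x. \<Sum>e\<in>B. (frechet_derivative g (at x) v \<bullet> e) *\<^sub>R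
        frechet_derivative f (at (g x)) e) S"
    proof (intro Ck_on_sum bounded_bilinear.Ck_on_bilinear[OF bounded_bilinear_scaleR]
        bounded_bilinear.Ck_on_bilinear[OF bounded_bilinear_inner] Ck_on_const Suc.prems(2))
      show "Ck_on k (\<lambda>x. frechet_derivative g (at x) v) S" using Suc.prems by simp
      show "Ck_on k (\<lambda>x. frechet_derivative f (at (g x)) e) S" for e
        using Suc.prems(3) Ck_on_SucD[OF Suc.prems(4)]
        by (intro Suc.IH[OF Suc.prems(1,2) _ _ Suc.prems(5)]) auto
    qed
  qed (rule eq)
  then show ?case using d by (auto simp: differentiable_def)
qed

lemma smooth_on_compose:
  fixes B :: "'b::real_inner set"
  assumes "parseval_frame B" "smooth_on f T" "smooth_on g S" "open S" "g ` S \<subseteq> T"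
  shows "smooth_on (\<lambda>x. f (g x :: 'b)) S"
  using assms Ck_on_compose unfolding smooth_on_def by blast

lemma Ck_on_linear_image:
  assumes "bounded_linear L" "open S" "Ck_on k f S"
  shows "Ck_on k (\<lambda>x. L (f x)) S"
  using assms(3)
proof (induction k arbitrary: f)
  case 0
  then show ?case using bounded_linear.continuous_on[OF assms(1)] by simp
next
  case (Suc k)
  have d: "((\<lambda>x. L (f x)) has_derivative (\<lambda>v. L (frechet_derivative f (at x) v))) (at x)"
    if "x \<in> S" for x
    using Suc.prems that
    by (intro bounded_linear.has_derivative[OF assms(1)] has_derivative_frechet) simp
  have "Ck_on k (\<lambda>x. frechet_derivative (\<lambda>x. L (f x)) (at x) v) S" for v
  proof (rule Ck_on_cong[OF assms(2)])
    show "Ck_on k (\<lambda>x. L (frechet_derivative f (at x) v)) S"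
      using Suc.prems by (simp add: Suc.IH)
  qed (simp add: frechet_derivative_eqI[OF d])
  then show ?case using d by (auto simp: differentiable_def)
qed

lemma smooth_on_linear_image:
  "bounded_linear L \<Longrightarrow> smooth_on f S \<Longrightarrow> open S \<Longrightarrow> smooth_on (\<lambda>x. L (f x)) S"
  by (simp add: smooth_on_def Ck_on_linear_image)

lemma smooth_on_Pair:
  assumes "smooth_on f S" "smooth_on g S" "open S"
  shows "smooth_on (\<lambda>x. (f x, g x)) S"
proof -
  have l: "bounded_linear (\<lambda>x. (x, 0))" "bounded_linear (\<lambda>x. (0, x))"
    by (intro bounded_linear_Pair bounded_linear_ident bounded_linear_zero)+
  have "smooth_on (\<lambda>x. (f x, 0) + (0, g x)) S"
    by (rule smooth_on_add[OF smooth_on_linear_image[OF l(1) assms(1,3)]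
          smooth_on_linear_image[OF l(2) assms(2,3)] assms(3)])
  then show ?thesis by simp
qed

text \<open>
The main source of smoothness below: coordinate expressions of differentials, of transported fields
and of their derivatives all have this shape.
\<close>

lemma smooth_on_frechet_along:
  fixes B :: "'b::real_inner set"
  assumes "parseval_frame B" "smooth_on f T" "smooth_on g S" "smooth_on h S" "open S" "g ` S \<subseteq> T"
  shows "smooth_on (\<lambda>x. frechet_derivative f (at (g x :: 'b)) (h x)) S"
proof (rule smooth_on_cong[OF _ assms(5)])
  show "smooth_on (\<lambda>x. \<Sum>e\<in>B. (h x \<bullet> e) *\<^sub>R frechet_derivative f (at (g x)) e) S"
    by (intro smooth_on_sum smooth_on_scaleR smooth_on_inner smooth_on_const assms
        smooth_on_compose[OF assms(1) smooth_on_frechet[OF assms(2)]])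
  fix x assume "x \<in> S"
  then show "(\<Sum>e\<in>B. (h x \<bullet> e) *\<^sub>R frechet_derivative f (at (g x)) e)
      = frechet_derivative f (at (g x)) (h x)"
    using assms(6)
    by (intro linear_parseval_frame[OF assms(1), symmetric] linear_frechet_derivative
        smooth_on_differentiable[OF assms(2)]) auto
qed


subsection \<open>A smooth function vanishing on a half-line\<close>

text \<open>
The functions \<open>p(1/t) exp(-1/t)\<close>, cut off at \<open>t \<le> 0\<close>.  All polynomials \<open>p\<close> are admitted because the
derivative leads from \<open>p\<close> to \<open>x\<^sup>2 (p - p')\<close>; the family is thus closed under differentiation.
\<close>

definition flat :: "real poly \<Rightarrow> real \<Rightarrow> real" where
  "flat p t = (if t > 0 then poly p (inverse t) * exp (- inverse t) else 0)"

lemma flat_tendsto_0: "(flat p \<longlongrightarrow> 0) (at 0)"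
proof (rule filterlim_split_at)
  show "(flat p \<longlongrightarrow> 0) (at_left 0)"
    by (rule tendsto_eventually) (auto simp: flat_def eventually_at_filter)
  have "((\<lambda>x::real. \<Sum>i\<le>degree p. coeff p i * (x ^ i / exp x)) \<longlongrightarrow> (\<Sum>i\<le>degree p. coeff p i * 0)) at_top"
    by (intro tendsto_intros tendsto_power_div_exp_0)
  then have "((\<lambda>x. poly p x * exp (- x)) \<longlongrightarrow> 0) at_top"
    by (simp add: poly_altdef sum_distrib_right exp_minus divide_inverse mult.assoc)
  then have "((\<lambda>t. poly p (inverse t) * exp (- inverse t)) \<longlongrightarrow> 0) (at_right 0)"
    by (rule filterlim_compose) (rule filterlim_inverse_at_top_right)
  then show "(flat p \<longlongrightarrow> 0) (at_right 0)"
    by (rule Lim_transform_eventually) (auto simp: flat_def eventually_at_filter)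
qed

lemma flat_has_derivative:
  "(flat p has_real_derivative flat ([:0, 0, 1:] * (p - pderiv p)) t) (at t)"
proof -
  consider "t > 0" | "t < 0" | "t = 0" by linarith
  then show ?thesis
  proof cases
    case 1
    have "((\<lambda>t. poly p (inverse t) * exp (- inverse t)) has_real_derivative
        flat ([:0, 0, 1:] * (p - pderiv p)) t) (at t)"
      using 1 by (auto intro!: derivative_eq_intros DERIV_chain'[OF _ poly_DERIV]
          simp: flat_def algebra_simps power2_eq_square)
    then show ?thesis
      by (rule has_field_derivative_transform_within_open[where S = "{0<..}"])
        (use 1 in \<open>auto simp: flat_def\<close>)
  next
    case 2
    have "((\<lambda>t. 0) has_real_derivative 0) (at t)" by simp
    then have "(flat p has_real_derivative 0) (at t)"
      by (rule has_field_derivative_transform_within_open[where S = "{..<0}"])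
        (use 2 in \<open>auto simp: flat_def\<close>)
    then show ?thesis using 2 by (simp add: flat_def)
  next
    case 3
    have "((\<lambda>h. (flat p (0 + h) - flat p 0) / h) \<longlongrightarrow> 0) (at 0)"
      using flat_tendsto_0[of "[:0, 1:] * p"]
      by (rule Lim_transform_eventually) (auto simp: flat_def eventually_at_filter divide_inverse)
    then show ?thesis using 3 by (simp add: DERIV_def flat_def)
  qed
qed

lemma smooth_on_flat: "smooth_on (flat p) UNIV"
proof -
  have "Ck_on k (flat p) UNIV" for k
  proof (induction k arbitrary: p)
    case 0
    show ?case
      by (auto intro!: continuous_at_imp_continuous_on DERIV_isCont[OF flat_has_derivative])
  next
    case (Suc k)
    have "flat p differentiable (at t)" for t
      using flat_has_derivative real_differentiable_def by blast
    moreover have "frechet_derivative (flat p) (at t) v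
        = flat (smult v ([:0, 0, 1:] * (p - pderiv p))) t" for t v
      using frechet_derivative_eqI[OF flat_has_derivative[unfolded has_field_derivative_def]]
      by (simp add: flat_def)
    ultimately show ?case using Suc by simp
  qed
  then show ?thesis by (simp add: smooth_on_def)
qed

text \<open>
Compose the flat function \<open>exp(-1/t)\<close> with \<open>r\<^sup>2 - \<bar>x - y\<bar>\<^sup>2\<close>.
\<close>

lemma smooth_bump_exists:
  fixes y :: "'a::real_inner"
  assumes "r > 0"
  shows "\<exists>\<phi>::'a \<Rightarrow> real. smooth_on \<phi> UNIV \<and> \<phi> y \<noteq> 0 \<and> (\<forall>x. x \<notin> cball y r \<longrightarrow> \<phi> x = 0)"
proof -
  let ?q = "\<lambda>x. r\<^sup>2 - (x - y) \<bullet> (x - y)"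
  have "smooth_on (\<lambda>x. x - y) UNIV"
    using smooth_on_add[OF smooth_on_ident smooth_on_const[of "- y"], of UNIV] by simp
  from smooth_on_mult[OF smooth_on_const[of "-1"] smooth_on_inner[OF this this]]
  have "smooth_on ?q UNIV"
    using smooth_on_add[OF smooth_on_const[of "r\<^sup>2"], of "\<lambda>x. - 1 * ((x - y) \<bullet> (x - y))"] by simp
  then have "smooth_on (\<lambda>x. flat 1 (?q x)) UNIV"
    using smooth_on_compose[OF parseval_frame_real smooth_on_flat] by blast
  moreover have "flat 1 (?q y) \<noteq> 0" using assms by (simp add: flat_def)
  moreover have "flat 1 (?q x) = 0" if "x \<notin> cball y r" for x
  proof -
    have "r \<le> norm (x - y)" using that by (simp add: dist_norm norm_minus_commute)
    then have "r\<^sup>2 \<le> (norm (x - y))\<^sup>2" using assms by (intro power_mono) auto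
    then show ?thesis by (simp add: flat_def dot_square_norm)
  qed
  ultimately show ?thesis by blast
qed

section \<open>Charts, differentials and vector fields\<close>

lemma chart_facts:
  assumes "is_chart c"
  shows open_cdom: "open (cdom c)" and open_cimg: "open (cimg c)"
    and cinv_cmap: "\<And>p. p \<in> cdom c \<Longrightarrow> cinv c (cmap c p) = p"
    and cmap_cinv: "\<And>y. y \<in> cimg c \<Longrightarrow> cmap c (cinv c y) = y"
    and cinv_cdom: "\<And>y. y \<in> cimg c \<Longrightarrow> cinv c y \<in> cdom c"
    and continuous_on_cmap: "continuous_on (cdom c) (cmap c)"
    and continuous_on_cinv: "continuous_on (cimg c) (cinv c)"
  using assms unfolding is_chart_def homeomorphism_def by (auto intro: inv_into_into)

lemma cmap_image_eq:
  assumes "is_chart c"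
  shows "cmap c ` (cdom c \<inter> U) = {y \<in> cimg c. cinv c y \<in> U}"
  using cinv_cmap[OF assms] cmap_cinv[OF assms] cinv_cdom[OF assms] by force

lemma open_cmap_image:
  assumes "is_chart c" "open U"
  shows "open (cmap c ` (cdom c \<inter> U))"
  using continuous_open_preimage[OF continuous_on_cinv[OF assms(1)] open_cimg[OF assms(1)] assms(2)]
  unfolding cmap_image_eq[OF assms(1)] by (simp add: vimage_def Int_def)

lemma smooth_atlas_chart: "smooth_atlas A \<Longrightarrow> c \<in> charts_at A p \<Longrightarrow> is_chart c"
  by (auto simp: smooth_atlas_def charts_at_def)

lemma charts_at_nonempty: "smooth_atlas A \<Longrightarrow> charts_at A p \<noteq> {}"
  unfolding smooth_atlas_def charts_at_def by blast

lemma some_chart_charts_at: "smooth_atlas A \<Longrightarrow> some_chart A p \<in> charts_at A p"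
  unfolding some_chart_def using charts_at_nonempty[of A p] by (simp add: some_in_eq)

lemma smooth_map_id: 
  assumes "smooth_atlas A"
  shows "smooth_map A A id"
  using assms unfolding smooth_map_def smooth_atlas_def by (auto simp: continuous_on_id)

text \<open>
The Jacobian of \<open>f\<close> at \<open>p\<close> with respect to a chart at \<open>p\<close> and one at \<open>f p\<close>.  With \<open>f = id\<close> it is the
Jacobian of a coordinate change, so that one chain rule serves for maps and for changes of charts.
\<close>

definition chart_deriv ::
  "('m, 'e::real_normed_vector) chart \<Rightarrow> ('n, 'f::real_normed_vector) chart \<Rightarrow> ('m \<Rightarrow> 'n) \<Rightarrow>
   'm \<Rightarrow> 'e \<Rightarrow> 'f" where
  "chart_deriv c d f p = frechet_derivative (cmap d \<circ> f \<circ> cinv c) (at (cmap c p))"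

lemma smooth_map_local:
  assumes "smooth_atlas A" "smooth_atlas B" "smooth_map A B f" "c \<in> A" "d \<in> B"
  shows "smooth_on (cmap d \<circ> f \<circ> cinv c) (cmap c ` (cdom c \<inter> f -` cdom d))"
    and "open (cmap c ` (cdom c \<inter> f -` cdom d))"
proof -
  show "smooth_on (cmap d \<circ> f \<circ> cinv c) (cmap c ` (cdom c \<inter> f -` cdom d))"
    using assms by (simp add: smooth_map_def)
  have "is_chart c" "is_chart d" using assms by (auto simp: smooth_atlas_def)
  moreover have "open (f -` cdom d)"
    using assms(3) open_cdom[OF \<open>is_chart d\<close>] by (simp add: smooth_map_def open_vimage)
  ultimately show "open (cmap c ` (cdom c \<inter> f -` cdom d))" by (simp add: open_cmap_image)
qed

lemma chart_deriv_has_derivative: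
  assumes "smooth_atlas A" "smooth_atlas B" "smooth_map A B f"
    and "c \<in> charts_at A p" "d \<in> charts_at B (f p)"
  shows "(cmap d \<circ> f \<circ> cinv c has_derivative chart_deriv c d f p) (at (cmap c p))"
  unfolding chart_deriv_def
  using assms by (intro smooth_on_has_derivative[OF smooth_map_local(1)[OF assms(1-3)]])
    (auto simp: charts_at_def)

lemma linear_chart_deriv:
  assumes "smooth_atlas A" "smooth_atlas B" "smooth_map A B f"
    and "c \<in> charts_at A p" "d \<in> charts_at B (f p)"
  shows "linear (chart_deriv c d f p)"
  using chart_deriv_has_derivative[OF assms] has_derivative_linear by blast

text \<open>
Near \<open>p\<close> the intermediate chart \<open>d\<close> cancels from the composite of the two coordinate expressions.
\<close>

lemma compose_has_chart_derivative:
  assumes "smooth_atlas A" "smooth_atlas B" "smooth_atlas C" "smooth_map A B f" "smooth_map B C g"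
    and "c \<in> charts_at A p" "d \<in> charts_at B (f p)" "e \<in> charts_at C (g (f p))"
  shows "(cmap e \<circ> (g \<circ> f) \<circ> cinv c has_derivative
    (\<lambda>u. chart_deriv d e g (f p) (chart_deriv c d f p u))) (at (cmap c p))"
proof -
  note ch = smooth_atlas_chart[OF assms(1,6)] smooth_atlas_chart[OF assms(2,7)]
  have p: "p \<in> cdom c" "f p \<in> cdom d" using assms by (auto simp: charts_at_def)
  have eq: "(cmap d \<circ> f \<circ> cinv c) (cmap c p) = cmap d (f p)" using p cinv_cmap[OF ch(1)] by simp
  let ?U = "cmap c ` (cdom c \<inter> f -` cdom d)"
  have "((cmap e \<circ> g \<circ> cinv d) \<circ> (cmap d \<circ> f \<circ> cinv c) has_derivative
      chart_deriv d e g (f p) \<circ> chart_deriv c d f p) (at (cmap c p))"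
    using chart_deriv_has_derivative[OF assms(2,3,5,7,8)] eq
    by (intro diff_chain_at chart_deriv_has_derivative[OF assms(1,2,4,6,7)]) simp
  then have "(cmap e \<circ> (g \<circ> f) \<circ> cinv c has_derivative
      chart_deriv d e g (f p) \<circ> chart_deriv c d f p) (at (cmap c p))"
  proof (rule has_derivative_transform_within_open)
    show "open ?U" using assms by (intro smooth_map_local) (auto simp: charts_at_def)
    show "cmap c p \<in> ?U" using p by auto
    show "((cmap e \<circ> g \<circ> cinv d) \<circ> (cmap d \<circ> f \<circ> cinv c)) y = (cmap e \<circ> (g \<circ> f) \<circ> cinv c) y"
      if "y \<in> ?U" for y
      using that cinv_cmap[OF ch(1)] cinv_cmap[OF ch(2)] by auto
  qed
  then show ?thesis by (simp add: o_def)
qed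

lemma chart_deriv_compose:
  assumes "smooth_atlas A" "smooth_atlas B" "smooth_atlas C" "smooth_map A B f" "smooth_map B C g"
    and "c \<in> charts_at A p" "d \<in> charts_at B (f p)" "e \<in> charts_at C (g (f p))"
  shows "chart_deriv c e (g \<circ> f) p u = chart_deriv d e g (f p) (chart_deriv c d f p u)"
  using frechet_derivative_eqI[OF compose_has_chart_derivative[OF assms]]
  by (simp add: chart_deriv_def)

lemma chart_deriv_id:
  assumes "smooth_atlas A" "c \<in> charts_at A p"
  shows "chart_deriv c c id p u = u"
proof -
  note ch = smooth_atlas_chart[OF assms]
  have "((\<lambda>y. y) has_derivative (\<lambda>u. u)) (at (cmap c p))" by (rule has_derivative_ident)
  then have "(cmap c \<circ> id \<circ> cinv c has_derivative (\<lambda>u. u)) (at (cmap c p))"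
    using assms(2) cmap_cinv[OF ch]
    by (elim has_derivative_transform_within_open[OF _ open_cimg[OF ch]]) (auto simp: charts_at_def)
  from frechet_derivative_eqI[OF this] show ?thesis by (simp add: chart_deriv_def)
qed

lemma tangent_space_iff:
  "v \<in> tangent_space A p \<longleftrightarrow> (\<forall>c. c \<notin> charts_at A p \<longrightarrow> v c = 0) \<and>
     (\<forall>c\<in>charts_at A p. \<forall>d\<in>charts_at A p. v d = chart_deriv c d id p (v c))"
  by (simp only: tangent_space_def chart_deriv_def comp_id mem_Collect_eq)

lemma tangent_space_chart:
  "v \<in> tangent_space A p \<Longrightarrow> c \<in> charts_at A p \<Longrightarrow> d \<in> charts_at A p \<Longrightarrow>
    v d = chart_deriv c d id p (v c)"
  unfolding tangent_space_iff by blast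

lemma tangent_space_0: "v \<in> tangent_space A p \<Longrightarrow> c \<notin> charts_at A p \<Longrightarrow> v c = 0"
  unfolding tangent_space_iff by blast

lemma tangent_spaceI:
  assumes "\<And>c. c \<notin> charts_at A p \<Longrightarrow> v c = 0"
    and "\<And>c d. c \<in> charts_at A p \<Longrightarrow> d \<in> charts_at A p \<Longrightarrow> v d = chart_deriv c d id p (v c)"
  shows "v \<in> tangent_space A p"
  unfolding tangent_space_iff using assms by blast

lemma coord_vec_chart:
  "coord_vec A c p u = (\<lambda>d. if d \<in> charts_at A p then chart_deriv c d id p u else 0)"
  by (simp only: coord_vec_def chart_deriv_def comp_id)

lemma coord_vec_tangent:
  assumes "smooth_atlas A" "c \<in> charts_at A p"
  shows "coord_vec A c p u \<in> tangent_space A p"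
proof (rule tangent_spaceI)
  fix d e assume "d \<in> charts_at A p" "e \<in> charts_at A p"
  then show "coord_vec A c p u e = chart_deriv d e id p (coord_vec A c p u d)"
    using chart_deriv_compose[OF assms(1) assms(1) assms(1) smooth_map_id smooth_map_id, of c p d e u]
      assms by (simp add: coord_vec_chart)
qed (simp add: coord_vec_chart)

lemma coord_vec_tangent_space:
  assumes "v \<in> tangent_space A p" "c \<in> charts_at A p"
  shows "coord_vec A c p (v c) = v"
  using tangent_space_chart[OF assms] tangent_space_0[OF assms(1)] by (auto simp: coord_vec_chart)

lemma tangent_space_eqI:
  assumes "v \<in> tangent_space A p" "w \<in> tangent_space A p" "c \<in> charts_at A p" "v c = w c"
  shows "v = w"
  using assms coord_vec_tangent_space by metis

lemma tangent_space_lincomb: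
  assumes "smooth_atlas A" "v \<in> tangent_space A p" "w \<in> tangent_space A p"
  shows "(\<lambda>c. a *\<^sub>R v c + b *\<^sub>R w c) \<in> tangent_space A p"
proof (rule tangent_spaceI)
  fix c d assume cd: "c \<in> charts_at A p" "d \<in> charts_at A p"
  interpret linear "chart_deriv c d id p"
    using cd by (intro linear_chart_deriv[OF assms(1,1) smooth_map_id[OF assms(1)]]) auto
  show "a *\<^sub>R v d + b *\<^sub>R w d = chart_deriv c d id p (a *\<^sub>R v c + b *\<^sub>R w c)"
    using tangent_space_chart[OF assms(2) cd] tangent_space_chart[OF assms(3) cd] 
    by (simp add: add scale)
qed (simp add: tangent_space_0[OF assms(2)] tangent_space_0[OF assms(3)])

lemma tangent_space_add:
  "smooth_atlas A \<Longrightarrow> v \<in> tangent_space A p \<Longrightarrow> w \<in> tangent_space A p \<Longrightarrow>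
    (\<lambda>c. v c + w c) \<in> tangent_space A p"
  using tangent_space_lincomb[of A v p w 1 1] by simp

lemma tangent_space_scale:
  "smooth_atlas A \<Longrightarrow> v \<in> tangent_space A p \<Longrightarrow> (\<lambda>c. a *\<^sub>R v c) \<in> tangent_space A p"
  using tangent_space_lincomb[of A v p v a 0] by simp


subsection \<open>The differential of a smooth map\<close>

text \<open>
The definition of the differential chooses a chart; by the chain rule, with the coordinate change as
first factor, any other chart gives the same vector.
\<close>

lemma differential_chart:
  assumes "smooth_atlas A" "smooth_atlas B" "smooth_map A B f" "v \<in> tangent_space A p"
    and "c \<in> charts_at A p" "d \<in> charts_at B (f p)"
  shows "differential A B f p v d = chart_deriv c d f p (v c)"
proof -
  let ?c = "some_chart A p"
  have c: "?c \<in> charts_at A p" by (rule some_chart_charts_at[OF assms(1)])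
  have "differential A B f p v d = chart_deriv ?c d f p (v ?c)"
    using assms(6) by (simp add: differential_def Let_def chart_deriv_def comp_assoc)
  also have "\<dots> = chart_deriv ?c d f p (chart_deriv c ?c id p (v c))"
    using tangent_space_chart[OF assms(4,5) c] by simp
  also have "\<dots> = chart_deriv c d f p (v c)"
    using chart_deriv_compose[OF assms(1,1,2) smooth_map_id[OF assms(1)] assms(3,5), of ?c d] c assms(6)
    by simp
  finally show ?thesis .
qed

lemma differential_outside: "d \<notin> charts_at B (f p) \<Longrightarrow> differential A B f p v d = 0"
  by (simp add: differential_def Let_def)

lemma differential_tangent:
  assumes "smooth_atlas A" "smooth_atlas B" "smooth_map A B f" "v \<in> tangent_space A p"
  shows "differential A B f p v \<in> tangent_space B (f p)"
proof (rule tangent_spaceI)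
  fix d e assume de: "d \<in> charts_at B (f p)" "e \<in> charts_at B (f p)"
  obtain c where c: "c \<in> charts_at A p" using charts_at_nonempty[OF assms(1)] by blast
  show "differential A B f p v e = chart_deriv d e id (f p) (differential A B f p v d)"
    using chart_deriv_compose[OF assms(1,2,2,3) smooth_map_id[OF assms(2)] c de(1), of e] de c
    by (simp add: differential_chart[OF assms c])
qed (simp add: differential_outside)

lemma differential_compose:
  assumes "smooth_atlas A" "smooth_atlas B" "smooth_atlas C" "smooth_map A B f" "smooth_map B C g"
    and "v \<in> tangent_space A p"
  shows "differential A C (g \<circ> f) p v = differential B C g (f p) (differential A B f p v)"
proof
  fix e
  let ?c = "some_chart A p"
  have c: "?c \<in> charts_at A p" by (rule some_chart_charts_at[OF assms(1)])
  obtain d where d: "d \<in> charts_at B (f p)" using charts_at_nonempty[OF assms(2)] by blast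
  show "differential A C (g \<circ> f) p v e = differential B C g (f p) (differential A B f p v) e"
  proof (cases "e \<in> charts_at C (g (f p))")
    case True
    then have "differential A C (g \<circ> f) p v e = chart_deriv ?c e (g \<circ> f) p (v ?c)"
      by (simp add: differential_def Let_def chart_deriv_def comp_assoc)
    also have "\<dots> = chart_deriv d e g (f p) (chart_deriv ?c d f p (v ?c))"
      by (rule chart_deriv_compose[OF assms(1-5) c d True])
    finally show ?thesis
      by (simp add: differential_chart[OF assms(1,2,4,6) c d]
          differential_chart[OF assms(2,3,5) differential_tangent[OF assms(1,2,4,6)] d True])
  qed (simp add: differential_outside)
qed

lemma differential_id:
  assumes "smooth_atlas A" "v \<in> tangent_space A p"
  shows "differential A A id p v = v"
proof -
  obtain c where c: "c \<in> charts_at A p" using charts_at_nonempty[OF assms(1)] by blast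
  show ?thesis
    using differential_tangent[OF assms(1,1) smooth_map_id[OF assms(1)] assms(2)]
      differential_chart[OF assms(1,1) smooth_map_id[OF assms(1)] assms(2) c, of c] c
    by (intro tangent_space_eqI[OF _ assms(2) c]) (auto simp: chart_deriv_id[OF assms(1) c])
qed

lemma differential_lincomb:
  assumes "smooth_atlas A" "smooth_atlas B" "smooth_map A B f"
    and "v \<in> tangent_space A p" "w \<in> tangent_space A p"
  shows "differential A B f p (\<lambda>c. a *\<^sub>R v c + b *\<^sub>R w c)
    = (\<lambda>d. a *\<^sub>R differential A B f p v d + b *\<^sub>R differential A B f p w d)"
proof
  fix d
  obtain c where c: "c \<in> charts_at A p" using charts_at_nonempty[OF assms(1)] by blast
  show "differential A B f p (\<lambda>c. a *\<^sub>R v c + b *\<^sub>R w c) d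
    = a *\<^sub>R differential A B f p v d + b *\<^sub>R differential A B f p w d"
  proof (cases "d \<in> charts_at B (f p)")
    case True
    interpret linear "chart_deriv c d f p" by (rule linear_chart_deriv[OF assms(1-3) c True])
    show ?thesis
      by (simp add: differential_chart[OF assms(1-3) _ c True] assms tangent_space_lincomb add scale)
  qed (simp add: differential_outside)
qed


subsection \<open>Smooth functions and vector fields\<close>

lemma smooth_atlas_real: "smooth_atlas {(UNIV, \<lambda>t::real. t)}"
proof -
  have [simp]: "inv (\<lambda>t::real. t) = (\<lambda>t. t)" by (rule inv_equality) auto
  show ?thesis
    by (auto simp: smooth_atlas_def is_chart_def homeomorphism_def o_def smooth_on_ident
        intro: continuous_on_id)
qed

lemma smooth_functionsD:
  assumes "smooth_atlas A" "f \<in> smooth_functions A" "c \<in> A"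
  shows "smooth_on (f \<circ> cinv c) (cimg c)"
proof -
  have "smooth_on ((\<lambda>t. t) \<circ> f \<circ> cinv c) (cimg c)"
    using assms(2,3) unfolding smooth_functions_def smooth_map_def by auto
  then show ?thesis by (simp add: o_def)
qed

lemma smooth_functionsI:
  assumes "smooth_atlas A" "\<And>c. c \<in> A \<Longrightarrow> smooth_on (f \<circ> cinv c) (cimg c)"
  shows "f \<in> smooth_functions A"
proof -
  have ch: "is_chart c" if "c \<in> A" for c using that assms(1) by (simp add: smooth_atlas_def)
  have "continuous_on (cdom c) f" if c: "c \<in> A" for c
  proof -
    have "continuous_on (cdom c) (\<lambda>q. (f \<circ> cinv c) (cmap c q))"
      by (rule continuous_on_compose2[OF smooth_on_continuous[OF assms(2)[OF c]]
            continuous_on_cmap[OF ch[OF c]]]) simp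
    then show ?thesis
      using cinv_cmap[OF ch[OF c]] by (auto cong: continuous_on_cong)
  qed
  then have "continuous_on (\<Union>c\<in>A. cdom c) f"
    using open_cdom[OF ch] by (intro continuous_on_open_UN)
  then have "continuous_on UNIV f" using assms(1) by (simp add: smooth_atlas_def)
  moreover have "(\<lambda>t. t) \<circ> f = f" by auto
  ultimately show ?thesis
    using assms(2) by (auto simp: smooth_functions_def smooth_map_def)
qed

text \<open>
The derivative of a function is its differential as a map to the real line, hence it can be computed
in any chart.
\<close>

lemma vf_deriv_chart:
  assumes "smooth_atlas A" "f \<in> smooth_functions A" "X p \<in> tangent_space A p" "c \<in> charts_at A p"
  shows "vf_deriv A X f p = frechet_derivative (f \<circ> cinv c) (at (cmap c p)) (X p c)"
proof -
  let ?R = "{(UNIV, \<lambda>t::real. t)}"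
  have f: "smooth_map A ?R f" using assms(2) by (simp add: smooth_functions_def)
  have id: "(\<lambda>t. t) \<circ> g = g" for g :: "'x \<Rightarrow> real" by auto
  have "(UNIV, \<lambda>t::real. t) \<in> charts_at ?R (f p)" by (simp add: charts_at_def)
  note * = differential_chart[OF assms(1) smooth_atlas_real f assms(3) _ this]
  have "vf_deriv A X f p = differential A ?R f p (X p) (UNIV, \<lambda>t::real. t)"
    using *[OF some_chart_charts_at[OF assms(1)]]
    by (simp add: vf_deriv_def Let_def chart_deriv_def id)
  then show ?thesis using *[OF assms(4)] by (simp add: chart_deriv_def id)
qed

lemma function_compose_has_derivative:
  assumes "smooth_atlas A" "g \<in> smooth_functions A" "smooth_map A A f"
    and "c \<in> charts_at A p" "d \<in> charts_at A (f p)"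
  shows "(g \<circ> f \<circ> cinv c has_derivative
    (\<lambda>u. frechet_derivative (g \<circ> cinv d) (at (cmap d (f p))) (chart_deriv c d f p u))) (at (cmap c p))"
proof -
  let ?R = "{(UNIV, \<lambda>t::real. t)}"
  have id: "(\<lambda>t. t) \<circ> g = g" for g :: "'x \<Rightarrow> real" by auto
  have g: "smooth_map A ?R g" using assms(2) by (simp add: smooth_functions_def)
  have "(UNIV, \<lambda>t::real. t) \<in> charts_at ?R (g (f p))" by (simp add: charts_at_def)
  from compose_has_chart_derivative[OF assms(1,1) smooth_atlas_real assms(3) g assms(4,5) this]
  show ?thesis by (simp add: chart_deriv_def id comp_assoc)
qed

lemma vector_fields_tangent: "X \<in> vector_fields A \<Longrightarrow> X p \<in> tangent_space A p"
  by (simp add: vector_fields_def)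

lemma vector_fields_smooth:
  "X \<in> vector_fields A \<Longrightarrow> c \<in> A \<Longrightarrow> smooth_on (\<lambda>y. X (cinv c y) c) (cimg c)"
  by (simp add: vector_fields_def)

lemma vector_fieldsI:
  assumes "\<And>p. X p \<in> tangent_space A p" "\<And>c. c \<in> A \<Longrightarrow> smooth_on (\<lambda>y. X (cinv c y) c) (cimg c)"
  shows "X \<in> vector_fields A"
  using assms by (simp add: vector_fields_def)

lemma vf_add_closed:
  assumes "smooth_atlas A" "X \<in> vector_fields A" "Y \<in> vector_fields A"
  shows "vf_add X Y \<in> vector_fields A"
  unfolding vf_add_def
proof (rule vector_fieldsI)
  fix c assume "c \<in> A"
  then show "smooth_on (\<lambda>y. X (cinv c y) c + Y (cinv c y) c) (cimg c)"
    using smooth_on_add[OF vector_fields_smooth[OF assms(2)] vector_fields_smooth[OF assms(3)]] assms(1)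
    by (auto simp: smooth_atlas_def is_chart_def)
qed (rule tangent_space_add[OF assms(1) vector_fields_tangent[OF assms(2)]
      vector_fields_tangent[OF assms(3)]])

lemma vf_scale_closed:
  assumes "smooth_atlas A" "f \<in> smooth_functions A" "X \<in> vector_fields A"
  shows "vf_scale f X \<in> vector_fields A"
  unfolding vf_scale_def
proof (rule vector_fieldsI)
  fix c assume "c \<in> A"
  then show "smooth_on (\<lambda>y. f (cinv c y) *\<^sub>R X (cinv c y) c) (cimg c)"
    using assms smooth_on_scaleR[OF smooth_functionsD[OF assms(1,2)] vector_fields_smooth[OF assms(3)]]
    by (auto simp: smooth_atlas_def is_chart_def)
qed (rule tangent_space_scale[OF assms(1) vector_fields_tangent[OF assms(3)]])


subsection \<open>Transport of vector fields by diffeomorphisms\<close>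

lemma diffeomorphism_id:
  assumes "smooth_atlas A"
  shows "diffeomorphism A A id"
  by (simp add: diffeomorphism_def smooth_map_id[OF assms] )

lemma diffeomorphism_smooth: "diffeomorphism A B f \<Longrightarrow> smooth_map A B f"
  by (simp add: diffeomorphism_def)

lemma diffeomorphism_inv: "diffeomorphism A B f \<Longrightarrow> inv f (f p) = p"
  by (simp add: diffeomorphism_def bij_is_inj)

lemma diffeomorphism_inv2: "diffeomorphism A B f \<Longrightarrow> f (inv f p) = p"
  by (simp add: diffeomorphism_def bij_is_surj surj_f_inv_f)

lemma vf_push_at:
  assumes "diffeomorphism A A f"
  shows "vf_push A f X (f p) = differential A A f p (X p)"
  by (simp add: vf_push_def diffeomorphism_inv[OF assms])

lemma vf_push_chart:
  assumes "smooth_atlas A" "diffeomorphism A A f" "X p \<in> tangent_space A p"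
    and "c \<in> charts_at A p" "d \<in> charts_at A (f p)"
  shows "vf_push A f X (f p) d = chart_deriv c d f p (X p c)"
  by (simp add: vf_push_at[OF assms(2)] 
      differential_chart[OF assms(1,1) diffeomorphism_smooth[OF assms(2)] assms(3-5)])

lemma vf_push_tangent:
  assumes "smooth_atlas A" "diffeomorphism A A f" "\<And>p. X p \<in> tangent_space A p"
  shows "vf_push A f X p \<in> tangent_space A p"
  using differential_tangent[OF assms(1,1) diffeomorphism_smooth[OF assms(2)] assms(3), of "inv f p"]
    vf_push_at[OF assms(2), of X "inv f p"] diffeomorphism_inv2[OF assms(2), of p] by simp

text \<open>
Locally the transported field is \<open>D f\<close> at \<open>f\<^sup>-\<^sup>1 y\<close> applied to the coordinate expression of \<open>X\<close> there.
\<close>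

lemma vf_push_closed:
  fixes B :: "'e::real_inner set" and A :: "('m::topological_space, 'e) chart set"
  assumes "parseval_frame B" "smooth_atlas A" "diffeomorphism A A f" "X \<in> vector_fields A"
  shows "vf_push A f X \<in> vector_fields A"
proof (rule vector_fieldsI)
  show "vf_push A f X p \<in> tangent_space A p" for p
    by (rule vf_push_tangent[OF assms(2,3) vector_fields_tangent[OF assms(4)]])
  note f = diffeomorphism_smooth[OF assms(3)]
  have g: "smooth_map A A (inv f)" using assms(3) by (simp add: diffeomorphism_def)
  fix c assume c: "c \<in> A"
  then have ch: "is_chart c" using assms(2) by (simp add: smooth_atlas_def)
  show "smooth_on (\<lambda>y. vf_push A f X (cinv c y) c) (cimg c)"
  proof (rule smooth_on_local)
    fix y assume y: "y \<in> cimg c"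
    obtain d where d: "d \<in> charts_at A (inv f (cinv c y))" using charts_at_nonempty[OF assms(2)] by blast
    note dh = smooth_atlas_chart[OF assms(2) d]
    have dA: "d \<in> A" using d by (simp add: charts_at_def)
    let ?T = "cmap c ` (cdom c \<inter> inv f -` cdom d)"
    let ?g = "cmap d \<circ> inv f \<circ> cinv c"
    note g' = smooth_map_local[OF assms(2,2) g c dA] and f' = smooth_map_local[OF assms(2,2) f dA c]
    have T: "z \<in> ?T \<longleftrightarrow> z \<in> cimg c \<and> inv f (cinv c z) \<in> cdom d" for z
      by (simp add: cmap_image_eq[OF ch] del: image_Int)
    have gz: "?g z \<in> cmap d ` (cdom d \<inter> f -` cdom c)" if "z \<in> ?T" for z
      using that cinv_cdom[OF ch, of z] unfolding T by (auto simp: diffeomorphism_inv2[OF assms(3)])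
    have "smooth_on (\<lambda>z. frechet_derivative (cmap c \<circ> f \<circ> cinv d) (at (?g z))
        (X (cinv d (?g z)) d)) ?T"
    proof (rule smooth_on_frechet_along[OF assms(1) f'(1) g'(1) _ g'(2)])
      show "smooth_on (\<lambda>z. X (cinv d (?g z)) d) ?T"
        using gz by (intro smooth_on_compose[OF assms(1) vector_fields_smooth[OF assms(4) dA] g'(1) g'(2)])
          blast
    qed (use gz in blast)
    then have "smooth_on (\<lambda>y. vf_push A f X (cinv c y) c) ?T"
    proof (rule smooth_on_cong[OF _ g'(2)])
      fix z assume z: "z \<in> ?T"
      let ?q = "inv f (cinv c z)"
      have q: "?q \<in> cdom d" "f ?q = cinv c z" "cinv c z \<in> cdom c" 
        using z cinv_cdom[OF ch, of z] unfolding T by (auto simp: diffeomorphism_inv2[OF assms(3)])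
      have "vf_push A f X (f ?q) c = chart_deriv d c f ?q (X ?q d)"
        using q dA c by (intro vf_push_chart[OF assms(2,3) vector_fields_tangent[OF assms(4)]])
          (auto simp: charts_at_def)
      then show "frechet_derivative (cmap c \<circ> f \<circ> cinv d) (at (?g z)) (X (cinv d (?g z)) d)
          = vf_push A f X (cinv c z) c"
        using q by (simp add: chart_deriv_def cinv_cmap[OF dh])
    qed
    moreover have "y \<in> ?T" unfolding T using y d by (simp add: charts_at_def)
    ultimately show "\<exists>T. open T \<and> y \<in> T \<and> smooth_on (\<lambda>y. vf_push A f X (cinv c y) c) T"
      using g'(2) by blast
  qed
qed

lemma vf_push_id:
  assumes "smooth_atlas A" "\<And>p. X p \<in> tangent_space A p"
  shows "vf_push A id X = X"
  by (simp add: vf_push_def differential_id[OF assms])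

lemma vf_push_compose:
  assumes "smooth_atlas A" "diffeomorphism A A f" "diffeomorphism A A g"
    and "\<And>p. X p \<in> tangent_space A p"
  shows "vf_push A (g \<circ> f) X = vf_push A g (vf_push A f X)"
proof
  fix p
  have "inv (g \<circ> f) = inv f \<circ> inv g"
    using assms(2,3) by (simp add: diffeomorphism_def o_inv_distrib)
  moreover have "f (inv f (inv g p)) = inv g p" by (rule diffeomorphism_inv2[OF assms(2)])
  ultimately show "vf_push A (g \<circ> f) X p = vf_push A g (vf_push A f X) p"
    using differential_compose[OF assms(1,1,1) assms(2,3)[THEN diffeomorphism_smooth] assms(4),
        of "inv f (inv g p)"]
    by (simp add: vf_push_def)
qed

lemma vf_push_add:
  assumes "smooth_atlas A" "diffeomorphism A A f"
    and "\<And>p. X p \<in> tangent_space A p" "\<And>p. Y p \<in> tangent_space A p"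
  shows "vf_push A f (vf_add X Y) = vf_add (vf_push A f X) (vf_push A f Y)"
  using differential_lincomb[OF assms(1,1) diffeomorphism_smooth[OF assms(2)] assms(3,4),
      where a = 1 and b = 1]
  by (simp add: vf_push_def vf_add_def)

lemma vf_push_scale:
  assumes "smooth_atlas A" "diffeomorphism A A f" "\<And>p. X p \<in> tangent_space A p"
  shows "vf_push A f (vf_scale h X) = vf_scale (h \<circ> inv f) (vf_push A f X)"
  using differential_lincomb[OF assms(1,1) diffeomorphism_smooth[OF assms(2)] assms(3,3), where b = 0]
  by (simp add: vf_push_def vf_scale_def)

section \<open>The derivative of a vector field at a zero\<close>

text \<open>
In the product rule for \<open>y \<mapsto> D F(y) (w y)\<close> the term with the second derivative of \<open>F\<close> is multiplied
by \<open>w x = 0\<close>.  This is why the derivative of a field at a zero is independent of the chart.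
\<close>

lemma has_derivative_frechet_apply_zero:
  fixes B :: "'a::real_inner set"
  assumes "parseval_frame B" "smooth_on F U" "x \<in> U" "open U" "w differentiable (at x)" "w x = 0"
  shows "((\<lambda>y. frechet_derivative F (at y) (w y :: 'a)) has_derivative
    (\<lambda>u. frechet_derivative F (at x) (frechet_derivative w (at x) u))) (at x)"
proof -
  let ?G = "\<lambda>e y. frechet_derivative F (at y) e"
  have lin: "frechet_derivative F (at y) v = (\<Sum>e\<in>B. (v \<bullet> e) *\<^sub>R ?G e y)" if "y \<in> U" for y v
    using smooth_on_differentiable[OF assms(2) that]
    by (intro linear_parseval_frame[OF assms(1)] linear_frechet_derivative)
  have "((\<lambda>y. \<Sum>e\<in>B. (w y \<bullet> e) *\<^sub>R ?G e y) has_derivative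
      (\<lambda>u. \<Sum>e\<in>B. (w x \<bullet> e) *\<^sub>R frechet_derivative (?G e) (at x) u
        + (frechet_derivative w (at x) u \<bullet> e) *\<^sub>R ?G e x)) (at x)"
    by (intro has_derivative_sum has_derivative_scaleR has_derivative_inner_left
        has_derivative_frechet[OF assms(5)]
        smooth_on_has_derivative[OF smooth_on_frechet[OF assms(2)] assms(3)])
  then have "((\<lambda>y. \<Sum>e\<in>B. (w y \<bullet> e) *\<^sub>R ?G e y) has_derivative
      (\<lambda>u. frechet_derivative F (at x) (frechet_derivative w (at x) u))) (at x)"
    by (simp add: assms(6) lin[OF assms(3), symmetric])
  then show ?thesis
    by (rule has_derivative_transform_within_open[OF _ assms(4,3)]) (rule lin[symmetric])
qed

text \<open>
At a zero \<open>p\<close> of \<open>W\<close> this is the derivative of \<open>W\<close> in the direction \<open>v\<close>, as a tangent vector at \<open>p\<close>.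
At other points the components in different charts do not fit together in general.
\<close>

definition zero_deriv ::
  "('m, 'e::real_normed_vector) chart set \<Rightarrow> ('m, 'e) vfield \<Rightarrow> 'm \<Rightarrow> ('m, 'e) tvec \<Rightarrow> ('m, 'e) tvec"
  where "zero_deriv A W p v =
    (\<lambda>c. if c \<in> charts_at A p
         then frechet_derivative (\<lambda>y. W (cinv c y) c) (at (cmap c p)) (v c) else 0)"

lemma vector_fields_has_derivative:
  assumes "X \<in> vector_fields A" "c \<in> charts_at A p"
  shows "((\<lambda>y. X (cinv c y) c) has_derivative
    frechet_derivative (\<lambda>y. X (cinv c y) c) (at (cmap c p))) (at (cmap c p))"
  using assms
  by (intro smooth_on_has_derivative[OF vector_fields_smooth[OF assms(1)]]) (auto simp: charts_at_def)

text \<open>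
If \<open>F\<close> is the coordinate expression of \<open>f\<close>, and \<open>w\<close>, \<open>w'\<close> are those of \<open>W\<close> and of its transport,
then \<open>w' \<circ> F = D F (w)\<close> near \<open>p\<close>.  Differentiate both sides at \<open>p\<close>.
\<close>

lemma zero_deriv_push_chart:
  fixes B :: "'e::real_inner set" and A :: "('m::topological_space, 'e) chart set"
  assumes "parseval_frame B" "smooth_atlas A" "diffeomorphism A A f"
    and "W \<in> vector_fields A" "W p = (\<lambda>c. 0)"
    and c: "c \<in> charts_at A p" and d: "d \<in> charts_at A (f p)"
  shows "frechet_derivative (\<lambda>z. vf_push A f W (cinv d z) d) (at (cmap d (f p))) (chart_deriv c d f p u)
    = chart_deriv c d f p (frechet_derivative (\<lambda>y. W (cinv c y) c) (at (cmap c p)) u)"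
proof -
  note f = diffeomorphism_smooth[OF assms(3)]
  have cd: "c \<in> A" "d \<in> A" "p \<in> cdom c" "f p \<in> cdom d" using c d by (auto simp: charts_at_def)
  note ch = smooth_atlas_chart[OF assms(2) c] and dh = smooth_atlas_chart[OF assms(2) d]
  let ?F = "cmap d \<circ> f \<circ> cinv c" and ?U = "cmap c ` (cdom c \<inter> f -` cdom d)"
  let ?w = "\<lambda>y. W (cinv c y) c" and ?w' = "\<lambda>z. vf_push A f W (cinv d z) d"
  note F = smooth_map_local[OF assms(2,2) f cd(1,2)]
  have p: "cmap c p \<in> ?U" using cd by auto
  have Fp: "?F (cmap c p) = cmap d (f p)" using cinv_cmap[OF ch cd(3)] by simp
  have "((\<lambda>y. ?w' (?F y)) has_derivative
      (\<lambda>u. frechet_derivative ?w' (at (cmap d (f p))) (chart_deriv c d f p u))) (at (cmap c p))"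
    using vector_fields_has_derivative[OF vf_push_closed[OF assms(1-4)] d] Fp
    by (intro has_derivative_compose[OF chart_deriv_has_derivative[OF assms(2,2) f c d]]) simp
  then have 1: "((\<lambda>y. frechet_derivative ?F (at y) (?w y)) has_derivative
      (\<lambda>u. frechet_derivative ?w' (at (cmap d (f p))) (chart_deriv c d f p u))) (at (cmap c p))"
  proof (rule has_derivative_transform_within_open[OF _ F(2) p])
    fix y assume "y \<in> ?U"
    then obtain q where q: "q \<in> cdom c" "f q \<in> cdom d" "y = cmap c q" by auto
    have "vf_push A f W (f q) d = chart_deriv c d f q (W q c)"
      using q cd by (intro vf_push_chart[OF assms(2,3) vector_fields_tangent[OF assms(4)]])
        (auto simp: charts_at_def)
    then show "?w' (?F y) = frechet_derivative ?F (at y) (?w y)"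
      using q by (simp add: cinv_cmap[OF ch] cinv_cmap[OF dh] chart_deriv_def)
  qed
  have 2: "((\<lambda>y. frechet_derivative ?F (at y) (?w y)) has_derivative
      (\<lambda>u. frechet_derivative ?F (at (cmap c p)) (frechet_derivative ?w (at (cmap c p)) u)))
      (at (cmap c p))"
    using vector_fields_has_derivative[OF assms(4) c] assms(5) cinv_cmap[OF ch cd(3)]
    by (intro has_derivative_frechet_apply_zero[OF assms(1) F(1) p F(2)])
      (auto simp: differentiable_def)
  from fun_cong[OF has_derivative_unique[OF 1 2], of u] show ?thesis by (simp add: chart_deriv_def)
qed

text \<open>
Independence of the chart is naturality under the identity map.
\<close>

lemma zero_deriv_tangent:
  fixes B :: "'e::real_inner set" and A :: "('m::topological_space, 'e) chart set"
  assumes "parseval_frame B" "smooth_atlas A" "W \<in> vector_fields A" "W p = (\<lambda>c. 0)"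
    and "v \<in> tangent_space A p"
  shows "zero_deriv A W p v \<in> tangent_space A p"
proof (rule tangent_spaceI)
  fix c d assume cd: "c \<in> charts_at A p" "d \<in> charts_at A p"
  then show "zero_deriv A W p v d = chart_deriv c d id p (zero_deriv A W p v c)"
    using zero_deriv_push_chart[OF assms(1,2) diffeomorphism_id[OF assms(2)] assms(3,4) cd(1), of d "v c"]
    by (simp add: zero_deriv_def vf_push_id[OF assms(2) vector_fields_tangent[OF assms(3)]]
        tangent_space_chart[OF assms(5) cd])
qed (simp add: zero_deriv_def)

lemma zero_deriv_push:
  fixes B :: "'e::real_inner set" and A :: "('m::topological_space, 'e) chart set"
  assumes "parseval_frame B" "smooth_atlas A" "diffeomorphism A A f"
    and "W \<in> vector_fields A" "W p = (\<lambda>c. 0)" "v \<in> tangent_space A p"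
  shows "zero_deriv A (vf_push A f W) (f p) (differential A A f p v)
    = differential A A f p (zero_deriv A W p v)"
proof
  fix d
  obtain c where c: "c \<in> charts_at A p" using charts_at_nonempty[OF assms(2)] by blast
  note diff = differential_chart[OF assms(2,2) diffeomorphism_smooth[OF assms(3)] _ c]
  show "zero_deriv A (vf_push A f W) (f p) (differential A A f p v) d
    = differential A A f p (zero_deriv A W p v) d"
  proof (cases "d \<in> charts_at A (f p)")
    case True
    show ?thesis
      unfolding diff[OF zero_deriv_tangent[OF assms(1,2,4,5,6)] True]
      using zero_deriv_push_chart[OF assms(1-5) c True, of "v c"] True c
      by (simp add: zero_deriv_def diff[OF assms(6) True])
  qed (simp add: zero_deriv_def differential_outside)
qed

lemma zero_deriv_lincomb_vector:
  assumes "W \<in> vector_fields A"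
  shows "zero_deriv A W p (\<lambda>c. a *\<^sub>R v c + b *\<^sub>R w c)
    = (\<lambda>c. a *\<^sub>R zero_deriv A W p v c + b *\<^sub>R zero_deriv A W p w c)"
proof
  fix c
  show "zero_deriv A W p (\<lambda>c. a *\<^sub>R v c + b *\<^sub>R w c) c
      = a *\<^sub>R zero_deriv A W p v c + b *\<^sub>R zero_deriv A W p w c"
  proof (cases "c \<in> charts_at A p")
    case True
    interpret linear "frechet_derivative (\<lambda>y. W (cinv c y) c) (at (cmap c p))"
      by (rule has_derivative_linear[OF vector_fields_has_derivative[OF assms True]])
    show ?thesis using True by (simp add: zero_deriv_def add scale)
  qed (simp add: zero_deriv_def)
qed

lemma zero_deriv_add_field:
  assumes "W \<in> vector_fields A" "Z \<in> vector_fields A"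
  shows "zero_deriv A (vf_add W Z) p v = (\<lambda>c. zero_deriv A W p v c + zero_deriv A Z p v c)"
proof
  fix c
  show "zero_deriv A (vf_add W Z) p v c = zero_deriv A W p v c + zero_deriv A Z p v c"
    using frechet_derivative_eqI[OF has_derivative_add[OF vector_fields_has_derivative[OF assms(1)]
          vector_fields_has_derivative[OF assms(2)]], of c p]
    by (simp add: zero_deriv_def vf_add_def)
qed


section \<open>Involutions at an isolated fixed point\<close>

text \<open>
The operator norm of \<open>D g(y)\<close> is at most the sum of \<open>\<bar>e\<bar> \<bar>D g(y) e\<bar>\<close> over the frame, a continuous
function of \<open>y\<close> that vanishes at \<open>x\<close>.
\<close>

lemma lipschitz_near_critical_point:
  fixes g :: "'a::real_inner \<Rightarrow> 'a" and B :: "'a set"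
  assumes "parseval_frame B" "smooth_on g U" "open U" "x \<in> U"
    and "frechet_derivative g (at x) = (\<lambda>u. 0)"
  shows "\<exists>r>0. cball x r \<subseteq> U \<and>
    (\<forall>y\<in>cball x r. \<forall>z\<in>cball x r. norm (g y - g z) \<le> 1/2 * norm (y - z))"
proof -
  define N where "N y = (\<Sum>e\<in>B. norm e * norm (frechet_derivative g (at y) e))" for y
  have "continuous_on U N"
    unfolding N_def using smooth_on_continuous[OF smooth_on_frechet[OF assms(2)]]
    by (intro continuous_intros)
  then have op: "open (N -` {..<1/2} \<inter> U)"
    by (rule continuous_on_open_vimage[OF assms(3), THEN iffD1, rule_format]) simp
  have x: "x \<in> N -` {..<1/2} \<inter> U" using assms by (simp add: N_def)
  from open_contains_cball[THEN iffD1, rule_format, OF op x]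
  obtain r where r: "r > 0" "cball x r \<subseteq> N -` {..<1/2} \<inter> U"
    by (elim exE conjE) (rule that)
  have "onorm (frechet_derivative g (at y)) \<le> 1/2" if y: "y \<in> cball x r" for y
  proof (rule onorm_bound)
    fix u
    have g: "linear (frechet_derivative g (at y))"
      using smooth_on_differentiable[OF assms(2)] r y by (intro linear_frechet_derivative) auto
    have "norm (frechet_derivative g (at y) u)
        = norm (\<Sum>e\<in>B. (u \<bullet> e) *\<^sub>R frechet_derivative g (at y) e)"
      by (simp add: linear_parseval_frame[OF assms(1) g, symmetric])
    also have "\<dots> \<le> (\<Sum>e\<in>B. norm ((u \<bullet> e) *\<^sub>R frechet_derivative g (at y) e))" by (rule norm_sum)
    also have "\<dots> \<le> (\<Sum>e\<in>B. (norm u * norm e) * norm (frechet_derivative g (at y) e))"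
      by (intro sum_mono) (simp add: mult_right_mono Cauchy_Schwarz_ineq2)
    also have "\<dots> = N y * norm u" by (simp add: N_def sum_distrib_left sum_distrib_right mult_ac)
    also have "\<dots> \<le> 1/2 * norm u" using r y by (intro mult_right_mono) auto
    finally show "norm (frechet_derivative g (at y) u) \<le> 1/2 * norm u" .
  qed simp
  note bound = this
  have "(g has_derivative frechet_derivative g (at y)) (at y within cball x r)"
    if "y \<in> cball x r" for y
    using that r(2) by (intro has_derivative_at_withinI[OF smooth_on_has_derivative[OF assms(2)]]) auto
  from differentiable_bound[OF convex_cball this bound]
  have "norm (g y - g z) \<le> 1/2 * norm (y - z)" if "y \<in> cball x r" "z \<in> cball x r" for y z
    using that by blast
  then show ?thesis using r by blast
qed

text \<open>
Let \<open>L = D \<sigma>(x)\<close>, so \<open>L\<^sup>2 = 1\<close>.  The map \<open>\<phi>(y) = (y + L (\<sigma> y)) / 2\<close> satisfies \<open>\<phi> \<circ> \<sigma> = L \<circ> \<phi>\<close> and has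
derivative 1 at \<open>x\<close>.  Suppose \<open>L v = v\<close>.  For small \<open>t\<close> a contraction argument solves
\<open>\<phi>(b) = \<phi>(x) + t v\<close>; this value is fixed by \<open>L\<close>, so \<open>\<phi>(\<sigma> b) = \<phi>(b)\<close>, and \<open>\<sigma> b = b\<close> because \<open>\<phi>\<close> is
injective near \<open>x\<close>.  Hence \<open>b = x\<close> and \<open>v = 0\<close>.  Applied to \<open>v = u + L u\<close> this gives \<open>L u = - u\<close>.
\<close>

lemma involution_derivative_isolated_fixed_point:
  fixes \<sigma> :: "'a::{real_inner,banach} \<Rightarrow> 'a" and B :: "'a set"
  assumes "parseval_frame B" "smooth_on \<sigma> U" "open U" "x \<in> U" "\<sigma> x = x"
    and invol: "\<And>y. y \<in> U \<Longrightarrow> \<sigma> (\<sigma> y) = y" and isolated: "\<And>y. y \<in> U \<Longrightarrow> \<sigma> y = y \<Longrightarrow> y = x"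
  shows "frechet_derivative \<sigma> (at x) u = - u"
proof -
  define L where "L = frechet_derivative \<sigma> (at x)"
  have der: "(\<sigma> has_derivative L) (at x)"
    unfolding L_def by (rule smooth_on_has_derivative[OF assms(2,4)])
  then interpret L: bounded_linear L by (rule has_derivative_bounded_linear)
  have LL: "L (L u) = u" for u
  proof -
    have "((\<lambda>y. \<sigma> (\<sigma> y)) has_derivative (\<lambda>u. L (L u))) (at x)"
      using der assms(5) by (intro has_derivative_compose[OF der]) simp
    then have "((\<lambda>y. y) has_derivative (\<lambda>u. L (L u))) (at x)"
      by (rule has_derivative_transform_within_open[OF _ assms(3,4)]) (rule invol)
    from has_derivative_unique[OF this has_derivative_ident] show ?thesis by (rule fun_cong)
  qed
  define g where "g y = (1/2) *\<^sub>R (L (\<sigma> y) + - y)" for y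
  have gder: "(g has_derivative (\<lambda>u. (1/2) *\<^sub>R (L (L u) + - u))) (at x)"
    unfolding g_def using der
    by (intro has_derivative_scaleR_right has_derivative_add has_derivative_minus has_derivative_ident
        bounded_linear.has_derivative[OF L.bounded_linear_axioms])
  have gU: "smooth_on g U"
    unfolding g_def
    by (intro smooth_on_scaleR smooth_on_const smooth_on_add assms(3)
        smooth_on_linear_image[OF L.bounded_linear_axioms assms(2,3)]
        smooth_on_linear_image[OF bounded_linear_minus[OF bounded_linear_ident] smooth_on_ident])
  have "frechet_derivative g (at x) = (\<lambda>u. 0)" using frechet_derivative_eqI[OF gder] by (simp add: LL)
  from lipschitz_near_critical_point[OF assms(1) gU assms(3,4) this]
  obtain r where r: "r > 0" "cball x r \<subseteq> U"
    and lip: "\<And>y z. y \<in> cball x r \<Longrightarrow> z \<in> cball x r \<Longrightarrow> norm (g y - g z) \<le> 1/2 * norm (y - z)"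
    by blast
  have op: "open (\<sigma> -` ball x r \<inter> U)"
    by (rule continuous_on_open_vimage[OF assms(3), THEN iffD1, rule_format,
          OF smooth_on_continuous[OF assms(2)]]) simp
  have x: "x \<in> \<sigma> -` ball x r \<inter> U" using assms(4,5) r(1) by simp
  from open_contains_cball[THEN iffD1, rule_format, OF op x]
  obtain r0 where r0: "r0 > 0" "cball x r0 \<subseteq> \<sigma> -` ball x r \<inter> U"
    by (elim exE conjE) (rule that)
  define r' where "r' = min r r0"
  have r': "r' > 0" "cball x r' \<subseteq> cball x r" "\<And>y. y \<in> cball x r' \<Longrightarrow> \<sigma> y \<in> cball x r"
    using r r0 by (auto simp: r'_def subset_iff less_imp_le)
  define v where "v = u + L u"
  have Lv: "L v = v" by (simp add: v_def L.add LL add.commute)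
  \<comment> \<open>Small enough that \<open>t v\<close> takes up at most half of the radius; the contraction takes the other half.\<close>
  define t where "t = r' / (2 * (norm v + 1))"
  have t: "t > 0" "norm (t *\<^sub>R v) \<le> r' / 2"
    using r' mult_right_mono[of "norm v" "norm v + 1" r']
    by (auto simp: t_def field_simps add_pos_nonneg)
  \<comment> \<open>A fixed point of \<open>T\<close> is a solution of \<open>\<phi>(b) = \<phi>(x) + t v\<close>.\<close>
  define T where "T y = x + t *\<^sub>R v - (g y - g x)" for y
  have "\<exists>!b\<in>cball x r'. T b = b"
  proof (rule Banach_fix[where c = "1/2"])
    show "complete (cball x r')" by (simp add: complete_eq_closed)
    show "T ` cball x r' \<subseteq> cball x r'"
    proof
      fix z assume "z \<in> T ` cball x r'"
      then obtain y where y: "y \<in> cball x r'" "z = T y" by blast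
      have "norm (g y - g x) \<le> 1/2 * norm (y - x)"
        using y(1) r'(2) r(1) by (intro lip) auto
      also have "\<dots> \<le> r' / 2" using y by (simp add: dist_norm norm_minus_commute)
      finally have "norm (t *\<^sub>R v - (g y - g x)) \<le> r'/2 + r'/2"
        using norm_triangle_ineq4[of "t *\<^sub>R v" "g y - g x"] t(2) by linarith
      moreover have "x - z = - (t *\<^sub>R v - (g y - g x))" by (simp add: y T_def)
      ultimately show "z \<in> cball x r'"
        by (metis dist_norm field_sum_of_halves mem_cball norm_minus_cancel)
    qed
    show "dist (T y) (T z) \<le> 1/2 * dist y z" if "y \<in> cball x r'" "z \<in> cball x r'" for y z
      using lip[OF subsetD[OF r'(2) that(1)] subsetD[OF r'(2) that(2)]]
      by (simp add: T_def dist_norm norm_minus_commute)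
  qed (use r' in auto)
  then obtain b where b: "b \<in> cball x r'" "T b = b" by blast
  define \<phi> where "\<phi> y = y + g y" for y
  have \<phi>: "\<phi> y = (1/2) *\<^sub>R (y + L (\<sigma> y))" for y
    unfolding \<phi>_def g_def by (simp add: scaleR_add_right scaleR_left_diff_distrib[symmetric] algebra_simps)
       (metis scaleR_half_double scaleR_add_right)
  have \<phi>b: "\<phi> b = \<phi> x + t *\<^sub>R v" using b(2) by (simp add: \<phi>_def T_def algebra_simps)
  have bU: "b \<in> U" using b r' r by blast
  have "\<phi> (\<sigma> b) = L (\<phi> b)"
    by (simp add: \<phi> invol[OF bU] L.add L.scaleR LL)
  also have "\<dots> = L (\<phi> x) + t *\<^sub>R v" by (simp add: \<phi>b L.add L.scaleR Lv)
  also have "L (\<phi> x) = \<phi> x" by (simp add: \<phi> assms(5) L.add L.scaleR LL add.commute)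
  finally have "\<phi> (\<sigma> b) = \<phi> b" using \<phi>b by simp
  then have "\<sigma> b - b = g b - g (\<sigma> b)" by (simp add: \<phi>_def algebra_simps)
  moreover have "norm (g b - g (\<sigma> b)) \<le> 1/2 * norm (b - \<sigma> b)"
    using b r' by (intro lip) auto
  ultimately have "norm (\<sigma> b - b) \<le> 1/2 * norm (b - \<sigma> b)" by presburger
  then have "norm (\<sigma> b - b) \<le> 1/2 * norm (\<sigma> b - b)" by (metis norm_minus_commute)
  then have "\<sigma> b = b" by simp
  then have "b = x" using isolated bU by blast
  then have "v = 0" using \<phi>b t(1) by simp
  then show ?thesis unfolding v_def L_def[symmetric] by (metis add.commute add_eq_0_iff)
qed


section \<open>Symmetric spaces\<close>

locale symmetric_space =
  fixes A :: "('m::{t2_space,second_countable_topology}, 'e::{real_inner,banach}) chart set"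
    and \<omega> :: "('m, 'e) form2" and s :: "'m \<Rightarrow> 'm \<Rightarrow> 'm" and B :: "'e set"
  assumes space: "symplectic_symmetric_space A \<omega> s" and frame: "parseval_frame B"
begin

lemma atlas: "smooth_atlas A"
  using space by (simp add: symplectic_symmetric_space_def connected_manifold_def)

lemma diffeo: "diffeomorphism A A (s x)"
  using space by (simp add: symplectic_symmetric_space_def symplectic_diffeomorphism_def)

lemmas smooth_sym = diffeomorphism_smooth[OF diffeo]

lemma invol: "s x (s x y) = y"
proof -
  have "s x \<circ> s x = id" using space by (simp add: symplectic_symmetric_space_def)
  then show ?thesis by (rule pointfree_idE)
qed

lemma invol_comp: "s x \<circ> s x = id"
  using invol by auto

lemma inv_sym: "inv (s x) = s x"
  by (rule inv_equality) (simp_all add: invol)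

lemma fixed: "s x x = x"
  using space by (simp add: symplectic_symmetric_space_def isolated_in_def)

lemma sym_conj: "s x \<circ> s y \<circ> s x = s (s x y)"
  using space by (simp add: symplectic_symmetric_space_def)

lemma sym_intertwine: "s x \<circ> s y = s (s x y) \<circ> s x"
proof -
  have "s (s x y) \<circ> s x = s x \<circ> s y \<circ> (s x \<circ> s x)" by (simp only: sym_conj[symmetric] comp_assoc)
  then show ?thesis by (simp add: invol_comp)
qed

lemma chart_deriv_sym:
  assumes c: "c \<in> charts_at A p"
  shows "chart_deriv c c (s p) p u = - u"
proof -
  note ch = smooth_atlas_chart[OF atlas c]
  have cA: "c \<in> A" "p \<in> cdom c" using c by (auto simp: charts_at_def)
  obtain T where T: "open T" "T \<inter> {y. s p y = y} = {p}"
    using space unfolding symplectic_symmetric_space_def isolated_in_def by blast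
  let ?\<sigma> = "cmap c \<circ> s p \<circ> cinv c"
  let ?U = "cmap c ` (cdom c \<inter> (s p -` cdom c \<inter> T))"
  note sm = smooth_map_local[OF atlas atlas smooth_sym cA(1,1), of p]
  have "open (s p -` cdom c \<inter> T)"
    using smooth_sym[of p] open_cdom[OF ch] T(1) by (auto simp: smooth_map_def intro!: open_Int open_vimage)
  then have U: "open ?U" by (rule open_cmap_image[OF ch])
  have "frechet_derivative ?\<sigma> (at (cmap c p)) u = - u"
  proof (rule involution_derivative_isolated_fixed_point[OF frame _ U])
    show "smooth_on ?\<sigma> ?U" by (rule smooth_on_subset[OF sm(1)]) auto
    show "cmap c p \<in> ?U" using cA T(2) by (auto simp: fixed)
    show "?\<sigma> (cmap c p) = cmap c p" using cA by (simp add: cinv_cmap[OF ch] fixed)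
    fix y assume "y \<in> ?U"
    then obtain q where q: "q \<in> cdom c" "s p q \<in> cdom c" "q \<in> T" "y = cmap c q" by auto
    then show "?\<sigma> (?\<sigma> y) = y" by (simp add: cinv_cmap[OF ch] invol)
    assume "?\<sigma> y = y"
    then have "cmap c (s p q) = cmap c q" using q by (simp add: cinv_cmap[OF ch])
    then have "s p q = q" using q(1,2) cinv_cmap[OF ch] by metis
    then have "q = p" using q T(2) by blast
    then show "y = cmap c p" using q by simp
  qed
  then show ?thesis by (simp add: chart_deriv_def)
qed

lemma differential_sym:
  assumes "v \<in> tangent_space A p"
  shows "differential A A (s p) p v = (\<lambda>c. - v c)"
proof
  fix c
  show "differential A A (s p) p v c = - v c"
  proof (cases "c \<in> charts_at A p")
    case True
    then show ?thesis
      using differential_chart[OF atlas atlas smooth_sym assms True, of c p] chart_deriv_sym[OF True]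
      by (simp add: fixed)
  next
    case False
    then show ?thesis using tangent_space_0[OF assms] differential_outside[of c A "s p" p A v]
      by (simp add: fixed)
  qed
qed

end

lemma covariant_derivativeI:
  assumes "\<And>X Y. X \<in> vector_fields A \<Longrightarrow> Y \<in> vector_fields A \<Longrightarrow> n X Y \<in> vector_fields A"
    and "\<And>X Y Z. \<lbrakk>X \<in> vector_fields A; Y \<in> vector_fields A; Z \<in> vector_fields A\<rbrakk> \<Longrightarrow>
      n (vf_add X Y) Z = vf_add (n X Z) (n Y Z) \<and> n X (vf_add Y Z) = vf_add (n X Y) (n X Z)"
    and "\<And>f X Y. \<lbrakk>f \<in> smooth_functions A; X \<in> vector_fields A; Y \<in> vector_fields A\<rbrakk> \<Longrightarrow>
      n (vf_scale f X) Y = vf_scale f (n X Y) \<and>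
      n X (vf_scale f Y) = vf_add (vf_scale (vf_deriv A X f) Y) (vf_scale f (n X Y))"
    and "smooth_atlas A"
  shows "covariant_derivative A (restrict (\<lambda>(X, Y). n X Y) (vector_fields A \<times> vector_fields A))"
  using assms(1-3) unfolding covariant_derivative_def
  by (auto simp: vf_add_closed[OF assms(4)] vf_scale_closed[OF assms(4)])

context symmetric_space
begin

section \<open>The canonical covariant derivative\<close>

text \<open>
The even part of \<open>Y\<close> under \<open>s\<^sub>p\<close>, up to a factor 2: invariant under \<open>s\<^sub>p\<close>, and zero at \<open>p\<close>.
\<close>

definition sym_sum :: "'m \<Rightarrow> ('m, 'e) vfield \<Rightarrow> ('m, 'e) vfield" where
  "sym_sum p Y = vf_add Y (vf_push A (s p) Y)"

text \<open>
The formula \<open>(\<nabla>\<^sub>X Y)(p) = 1/2 D\<^bsub>X(p)\<^esub> (Y + (s\<^sub>p)\<^sub>* Y)\<close>.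
\<close>

definition canonical_nabla :: "('m, 'e) vfield \<Rightarrow> ('m, 'e) vfield \<Rightarrow> ('m, 'e) vfield" where
  "canonical_nabla X Y = (\<lambda>p c. (1/2) *\<^sub>R zero_deriv A (sym_sum p Y) p (X p) c)"

lemma push_closed: "Y \<in> vector_fields A \<Longrightarrow> vf_push A (s p) Y \<in> vector_fields A"
  by (rule vf_push_closed[OF frame atlas diffeo])

lemma push_at_center:
  assumes "Y \<in> vector_fields A"
  shows "vf_push A (s p) Y p = (\<lambda>c. - Y p c)"
  using vf_push_at[OF diffeo, of p Y p] differential_sym[OF vector_fields_tangent[OF assms]]
  by (simp add: fixed)

lemma sym_sum_closed: "Y \<in> vector_fields A \<Longrightarrow> sym_sum p Y \<in> vector_fields A"
  unfolding sym_sum_def by (rule vf_add_closed[OF atlas _ push_closed])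

lemma sym_sum_zero: "Y \<in> vector_fields A \<Longrightarrow> sym_sum p Y p = (\<lambda>c. 0)"
  by (simp add: sym_sum_def vf_add_def push_at_center)

lemma zero_deriv_sym_sum_tangent:
  assumes "X \<in> vector_fields A" "Y \<in> vector_fields A"
  shows "zero_deriv A (sym_sum p Y) p (X p) \<in> tangent_space A p"
  by (rule zero_deriv_tangent[OF frame atlas sym_sum_closed[OF assms(2)] sym_sum_zero[OF assms(2)]
        vector_fields_tangent[OF assms(1)]])

lemma canonical_nabla_tangent:
  assumes "X \<in> vector_fields A" "Y \<in> vector_fields A"
  shows "canonical_nabla X Y p \<in> tangent_space A p"
  unfolding canonical_nabla_def by (rule tangent_space_scale[OF atlas zero_deriv_sym_sum_tangent[OF assms]])

text \<open>
The coordinate expression of \<open>(x, y) \<mapsto> s\<^sub>x y\<close> near the diagonal, with the same chart in all three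
places; the diagonal belongs to \<open>U\<close> because \<open>s\<^sub>x x = x\<close>.
\<close>

lemma sym_smooth_chart:
  assumes "c \<in> A"
  defines "\<sigma> \<equiv> \<lambda>z. cmap c (s (cinv c (fst z)) (cinv c (snd z)))"
    and "U \<equiv> {z. fst z \<in> cimg c \<and> snd z \<in> cimg c \<and> s (cinv c (fst z)) (cinv c (snd z)) \<in> cdom c}"
  shows "open U" "smooth_on \<sigma> U"
proof -
  have ch: "is_chart c" using assms(1) atlas by (simp add: smooth_atlas_def)
  let ?S = "\<lambda>(x, y). s x y"
  have S: "smooth_map (prod_atlas A A) A ?S"
    using space by (simp add: symplectic_symmetric_space_def)
  let ?i = "\<lambda>z. (cinv c (fst z), cinv c (snd z))"
  have "continuous_on (cimg c \<times> cimg c) ?i"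
    by (intro continuous_on_Pair continuous_on_compose2[OF continuous_on_cinv[OF ch]]
        continuous_on_fst continuous_on_snd continuous_on_id) auto
  moreover have "open (?S -` cdom c)"
    using S open_cdom[OF ch] by (simp add: smooth_map_def open_vimage)
  ultimately have "open ((cimg c \<times> cimg c) \<inter> ?i -` (?S -` cdom c))"
    using open_cimg[OF ch] by (intro continuous_open_preimage open_Times)
  moreover have "(cimg c \<times> cimg c) \<inter> ?i -` (?S -` cdom c) = U"
    by (auto simp: U_def)
  ultimately show U: "open U" by simp
  let ?P = "(cdom c \<times> cdom c, map_prod (cmap c) (cmap c))"
  have inj: "inj_on (map_prod (cmap c) (cmap c)) (cdom c \<times> cdom c)"
    using cinv_cmap[OF ch] by (intro map_prod_inj_on) (metis inj_onI)+
  have inv: "cinv ?P z = ?i z" if "fst z \<in> cimg c" "snd z \<in> cimg c" for z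
    unfolding snd_conv fst_conv using that cmap_cinv[OF ch] cinv_cdom[OF ch]
    by (intro inv_into_f_eq[OF inj]) (auto simp: prod_eq_iff)
  have "U \<subseteq> cmap ?P ` (cdom ?P \<inter> ?S -` cdom c)"
  proof
    fix z assume z: "z \<in> U"
    have "z = map_prod (cmap c) (cmap c) (?i z)"
      using z cmap_cinv[OF ch] by (auto simp: U_def prod_eq_iff)
    moreover have "?i z \<in> (cdom c \<times> cdom c) \<inter> ?S -` cdom c"
      using z cinv_cdom[OF ch] by (simp add: U_def)
    ultimately show "z \<in> cmap ?P ` (cdom ?P \<inter> ?S -` cdom c)" by (simp only: fst_conv snd_conv image_eqI)
  qed
  moreover have "?P \<in> prod_atlas A A" unfolding prod_atlas_def using assms(1) by blast
  ultimately have "smooth_on (cmap c \<circ> ?S \<circ> cinv ?P) U"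
    using S assms(1) unfolding smooth_map_def by (meson smooth_on_subset)
  then show "smooth_on \<sigma> U"
    by (rule smooth_on_cong[OF _ U]) (simp only: comp_apply inv U_def mem_Collect_eq \<sigma>_def prod.case)
qed

text \<open>
The centre of the symmetry moves with the point of evaluation.  In coordinates, the field
\<open>Y + (s\<^sub>x)\<^sub>* Y\<close> is a function \<open>K(x, b)\<close> of the centre and the point, jointly smooth on a neighbourhood
of the diagonal, and \<open>\<nabla>\<^sub>X Y\<close> is half its partial derivative in \<open>b\<close> on the diagonal, along \<open>X\<close>.
\<close>

lemma canonical_nabla_smooth:
  assumes "X \<in> vector_fields A" "Y \<in> vector_fields A" "c \<in> A"
  shows "smooth_on (\<lambda>y. canonical_nabla X Y (cinv c y) c) (cimg c)"
proof -
  have ch: "is_chart c" using assms(3) atlas by (simp add: smooth_atlas_def)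
  define \<sigma> where "\<sigma> = (\<lambda>z. cmap c (s (cinv c (fst z)) (cinv c (snd z))))"
  define U where "U = {z. fst z \<in> cimg c \<and> snd z \<in> cimg c \<and>
    s (cinv c (fst z)) (cinv c (snd z)) \<in> cdom c}"
  have U: "open U" and \<sigma>: "smooth_on \<sigma> U"
    using sym_smooth_chart[OF assms(3)] by (simp_all add: \<sigma>_def U_def)
  obtain F :: "('e \<times> 'e) set" where F: "parseval_frame F"
    using parseval_frame_Times[OF frame frame] by blast
  have \<sigma>img: "\<sigma> z \<in> cimg c" "cinv c (\<sigma> z) = s (cinv c (fst z)) (cinv c (snd z))" if "z \<in> U" for z
    using that cinv_cmap[OF ch] by (auto simp: U_def \<sigma>_def)
  \<comment> \<open>The set \<open>U\<close> is stable under \<open>(x, y) \<mapsto> (x, s\<^sub>x y)\<close>, as \<open>s\<^sub>x\<close> is an involution.\<close>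
  have Uinv: "(fst z, \<sigma> z) \<in> U" if "z \<in> U" for z
    using \<sigma>img[OF that] that cinv_cdom[OF ch] by (simp add: U_def invol)
  have diag: "(y, y) \<in> U" if "y \<in> cimg c" for y
    using that cinv_cdom[OF ch] by (simp add: U_def fixed)
  have fst: "smooth_on fst U" and snd: "smooth_on snd U"
    by (intro smooth_on_bounded_linear bounded_linear_fst bounded_linear_snd)+
  let ?Y = "\<lambda>y. Y (cinv c y) c"
  \<comment> \<open>The second term is \<open>(s\<^sub>x)\<^sub>* Y\<close>: the partial differential of \<open>s\<^sub>x\<close> at \<open>s\<^sub>x y\<close>, the preimage of \<open>y\<close>.\<close>
  define K where "K z = ?Y (snd z) + frechet_derivative \<sigma> (at (fst z, \<sigma> z)) (0, ?Y (\<sigma> z))" for z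
  have K: "smooth_on K U"
  proof -
    have "smooth_on (\<lambda>z. ?Y (snd z)) U"
      by (rule smooth_on_compose[OF frame vector_fields_smooth[OF assms(2,3)] snd U]) (auto simp: U_def)
    moreover have "smooth_on (\<lambda>z. (0, ?Y (\<sigma> z))) U"
      using \<sigma>img(1)
      by (intro smooth_on_Pair smooth_on_const U
          smooth_on_compose[OF frame vector_fields_smooth[OF assms(2,3)] \<sigma> U])
        blast
    ultimately show ?thesis
      unfolding K_def using Uinv
      by (intro smooth_on_add[OF _ smooth_on_frechet_along[OF F \<sigma> smooth_on_Pair[OF fst \<sigma> U] _ U] U])
         auto
  qed
  have slice: "((\<lambda>b. f (y, b)) has_derivative (\<lambda>u. frechet_derivative f (at (y, b)) (0, u))) (at b)"
    if "smooth_on f U" "(y, b) \<in> U" for f :: "'e \<times> 'e \<Rightarrow> 'e" and y b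
    by (rule has_derivative_compose[OF has_derivative_Pair[OF has_derivative_const has_derivative_ident]
          smooth_on_has_derivative[OF that]])
  have sum: "sym_sum (cinv c y) Y (cinv c b) c = K (y, b)" if yb: "(y, b) \<in> U" for y b
  proof -
    let ?p = "cinv c y" and ?q = "cinv c (\<sigma> (y, b))"
    have q: "?q = s ?p (cinv c b)" "s ?p ?q = cinv c b" using \<sigma>img(2)[OF yb] by (simp_all add: invol)
    have b: "b \<in> cimg c" using yb by (simp add: U_def)
    have "vf_push A (s ?p) Y (s ?p ?q) c = chart_deriv c c (s ?p) ?q (Y ?q c)"
      using assms(3) cinv_cdom[OF ch \<sigma>img(1)[OF yb]] cinv_cdom[OF ch b] q
      by (intro vf_push_chart[OF atlas diffeo vector_fields_tangent[OF assms(2)]])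
        (simp_all add: charts_at_def)
    also have "\<dots> = frechet_derivative (\<lambda>b. \<sigma> (y, b)) (at (\<sigma> (y, b))) (Y ?q c)"
      using cmap_cinv[OF ch \<sigma>img(1)[OF yb]] by (simp add: chart_deriv_def o_def \<sigma>_def)
    also have "\<dots> = frechet_derivative \<sigma> (at (y, \<sigma> (y, b))) (0, Y ?q c)"
      using frechet_derivative_eqI[OF slice[OF \<sigma>]] Uinv[OF yb] by simp
    finally show ?thesis using q(2) by (simp add: sym_sum_def vf_add_def K_def)
  qed
  have eq: "canonical_nabla X Y (cinv c y) c
      = (1/2) *\<^sub>R frechet_derivative K (at (y, y)) (0, X (cinv c y) c)"
    if y: "y \<in> cimg c" for y
  proof -
    have "((\<lambda>b. sym_sum (cinv c y) Y (cinv c b) c) has_derivative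
        (\<lambda>u. frechet_derivative K (at (y, y)) (0, u))) (at y)"
    proof (rule has_derivative_transform_within_open[OF slice[OF K diag[OF y]]])
      show "open ((\<lambda>b. (y, b)) -` U)" by (intro open_vimage U continuous_intros)
      show "y \<in> (\<lambda>b. (y, b)) -` U" using diag[OF y] by simp
    qed (simp add: sum)
    from frechet_derivative_eqI[OF this] show ?thesis
      using y assms(3) cinv_cdom[OF ch y] cmap_cinv[OF ch y]
      by (simp add: canonical_nabla_def zero_deriv_def charts_at_def)
  qed
  have "smooth_on (\<lambda>y. (1/2) *\<^sub>R frechet_derivative K (at (y, y)) (0, X (cinv c y) c)) (cimg c)"
    using diag
    by (intro smooth_on_scaleR smooth_on_const open_cimg[OF ch] smooth_on_frechet_along[OF F K]
        smooth_on_Pair smooth_on_ident vector_fields_smooth[OF assms(1,3)]) auto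
  then show ?thesis by (rule smooth_on_cong[OF _ open_cimg[OF ch]]) (simp add: eq)
qed

lemma canonical_nabla_closed:
  "X \<in> vector_fields A \<Longrightarrow> Y \<in> vector_fields A \<Longrightarrow> canonical_nabla X Y \<in> vector_fields A"
  by (rule vector_fieldsI[OF canonical_nabla_tangent canonical_nabla_smooth])

lemma canonical_nabla_add_left:
  assumes "Z \<in> vector_fields A"
  shows "canonical_nabla (vf_add X Y) Z = vf_add (canonical_nabla X Z) (canonical_nabla Y Z)"
  using zero_deriv_lincomb_vector[OF sym_sum_closed[OF assms], of _ _ 1 _ 1]
  by (simp add: canonical_nabla_def vf_add_def scaleR_add_right)

lemma canonical_nabla_scale_left:
  assumes "Y \<in> vector_fields A"
  shows "canonical_nabla (vf_scale f X) Y = vf_scale f (canonical_nabla X Y)"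
  using zero_deriv_lincomb_vector[OF sym_sum_closed[OF assms], where b = 0]
  by (simp add: canonical_nabla_def vf_scale_def mult.commute)

lemma canonical_nabla_add_right:
  assumes "Y \<in> vector_fields A" "Z \<in> vector_fields A"
  shows "canonical_nabla X (vf_add Y Z) = vf_add (canonical_nabla X Y) (canonical_nabla X Z)"
proof -
  have "sym_sum p (vf_add Y Z) = vf_add (sym_sum p Y) (sym_sum p Z)" for p
    using vf_push_add[OF atlas diffeo vector_fields_tangent[OF assms(1)] vector_fields_tangent[OF assms(2)]]
    by (simp add: sym_sum_def vf_add_def algebra_simps)
  then show ?thesis
    using zero_deriv_add_field[OF sym_sum_closed[OF assms(1)] sym_sum_closed[OF assms(2)]]
    by (simp add: canonical_nabla_def vf_add_def[of "\<lambda>p c. _ p c"] scaleR_add_right)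
qed

text \<open>
With \<open>Y' = (s\<^sub>p)\<^sub>* Y\<close>, the field to be differentiated is \<open>h Y + (h \<circ> s\<^sub>p) Y'\<close>.  At \<open>p\<close> both \<open>h \<circ> s\<^sub>p\<close> and
\<open>Y'\<close> contribute a minus sign to the second term, so the two copies of \<open>d h(X) Y\<close> add up.
\<close>

lemma canonical_nabla_Leibniz:
  assumes "h \<in> smooth_functions A" "X \<in> vector_fields A" "Y \<in> vector_fields A"
  shows "canonical_nabla X (vf_scale h Y)
    = vf_add (vf_scale (vf_deriv A X h) Y) (vf_scale h (canonical_nabla X Y))"
proof (intro ext)
  fix p c
  show "canonical_nabla X (vf_scale h Y) p c
    = vf_add (vf_scale (vf_deriv A X h) Y) (vf_scale h (canonical_nabla X Y)) p c"
  proof (cases "c \<in> charts_at A p")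
    case c: True
    note ch = smooth_atlas_chart[OF atlas c]
    have cA: "c \<in> A" "p \<in> cdom c" using c by (auto simp: charts_at_def)
    let ?Y' = "vf_push A (s p) Y" and ?x = "cmap c p"
    let ?D = "\<lambda>X. frechet_derivative (\<lambda>y. X (cinv c y) c) (at ?x)"
    let ?dh = "frechet_derivative (h \<circ> cinv c) (at ?x)"
    have dh: "(h \<circ> cinv c has_derivative ?dh) (at ?x)"
      using cA by (intro smooth_on_has_derivative[OF smooth_functionsD[OF atlas assms(1)]]) auto
    then interpret dh: linear ?dh by (rule has_derivative_linear)
    have dh': "(h \<circ> s p \<circ> cinv c has_derivative (\<lambda>u. - ?dh u)) (at ?x)"
      using function_compose_has_derivative[OF atlas assms(1) smooth_sym c, of c p] c
      by (simp add: fixed chart_deriv_sym dh.neg)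
    have DY: "((\<lambda>y. Y (cinv c y) c) has_derivative ?D Y) (at ?x)"
      and DY': "((\<lambda>y. ?Y' (cinv c y) c) has_derivative ?D ?Y') (at ?x)"
      by (rule vector_fields_has_derivative[OF _ c], use assms push_closed in simp)+
    have "sym_sum p (vf_scale h Y) = vf_add (vf_scale h Y) (vf_scale (h \<circ> s p) ?Y')"
      using vf_push_scale[OF atlas diffeo vector_fields_tangent[OF assms(3)]]
      by (simp add: sym_sum_def inv_sym)
    then have fn: "(\<lambda>y. sym_sum p (vf_scale h Y) (cinv c y) c) =
        (\<lambda>y. (h \<circ> cinv c) y *\<^sub>R Y (cinv c y) c + (h \<circ> s p \<circ> cinv c) y *\<^sub>R ?Y' (cinv c y) c)"
      by (simp add: vf_add_def vf_scale_def)
    have "((\<lambda>y. sym_sum p (vf_scale h Y) (cinv c y) c) has_derivative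
        (\<lambda>u. ((h \<circ> cinv c) ?x *\<^sub>R ?D Y u + ?dh u *\<^sub>R Y (cinv c ?x) c) +
          ((h \<circ> s p \<circ> cinv c) ?x *\<^sub>R ?D ?Y' u + (- ?dh u) *\<^sub>R ?Y' (cinv c ?x) c))) (at ?x)"
      unfolding fn by (intro has_derivative_add has_derivative_scaleR dh dh' DY DY')
    then have "zero_deriv A (sym_sum p (vf_scale h Y)) p (X p) c =
        h p *\<^sub>R (?D Y (X p c) + ?D ?Y' (X p c)) + (2 * ?dh (X p c)) *\<^sub>R Y p c"
      using c cinv_cmap[OF ch cA(2)] push_at_center[OF assms(3)]
      by (simp add: zero_deriv_def frechet_derivative_eqI fixed algebra_simps scaleR_2[symmetric])
    moreover have "zero_deriv A (sym_sum p Y) p (X p) c = ?D Y (X p c) + ?D ?Y' (X p c)"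
      using c zero_deriv_add_field[OF assms(3) push_closed[OF assms(3)]]
      by (simp add: sym_sum_def zero_deriv_def)
    moreover have "vf_deriv A X h p = ?dh (X p c)"
      by (rule vf_deriv_chart[where X = X and p = p, OF atlas assms(1) vector_fields_tangent[OF assms(2)] c])
    ultimately show ?thesis
      by (simp add: canonical_nabla_def vf_add_def vf_scale_def scaleR_add_right)
  next
    case False
    then show ?thesis
      using tangent_space_0[OF vector_fields_tangent[OF assms(3)] False]
      by (simp add: canonical_nabla_def zero_deriv_def vf_add_def vf_scale_def)
  qed
qed

text \<open>
This is the intertwining relation \<open>s\<^sub>x s\<^sub>p = s\<^bsub>s\<^sub>x p\<^esub> s\<^sub>x\<close>.
\<close>

lemma push_sym_sum:
  assumes "Y \<in> vector_fields A"
  shows "vf_push A (s x) (sym_sum p Y) = sym_sum (s x p) (vf_push A (s x) Y)"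
proof -
  note tan = vector_fields_tangent[OF assms]
  have "vf_push A (s x) (vf_push A (s p) Y) = vf_push A (s (s x p)) (vf_push A (s x) Y)"
    using vf_push_compose[OF atlas diffeo diffeo tan] sym_intertwine by metis
  then show ?thesis
    using vf_push_add[OF atlas diffeo tan vector_fields_tangent[OF push_closed[OF assms]]]
    by (simp add: sym_sum_def)
qed

lemma canonical_nabla_affine:
  assumes "X \<in> vector_fields A" "Y \<in> vector_fields A"
  shows "vf_push A (s x) (canonical_nabla X Y) = canonical_nabla (vf_push A (s x) X) (vf_push A (s x) Y)"
proof
  fix q
  obtain p where q: "q = s x p" by (metis invol)
  let ?zd = "zero_deriv A (sym_sum p Y) p (X p)"
  have "vf_push A (s x) (canonical_nabla X Y) (s x p) = differential A A (s x) p (\<lambda>c. (1/2) *\<^sub>R ?zd c)"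
    by (simp add: vf_push_at[OF diffeo] canonical_nabla_def)
  also have "\<dots> = (\<lambda>c. (1/2) *\<^sub>R differential A A (s x) p ?zd c)"
    using differential_lincomb[OF atlas atlas smooth_sym, of ?zd p ?zd x "1/2" 0]
      zero_deriv_sym_sum_tangent[OF assms] by simp
  also have "differential A A (s x) p ?zd
      = zero_deriv A (sym_sum (s x p) (vf_push A (s x) Y)) (s x p) (vf_push A (s x) X (s x p))"
    using zero_deriv_push[OF frame atlas diffeo sym_sum_closed[OF assms(2)] sym_sum_zero[OF assms(2)]
        vector_fields_tangent[OF assms(1)], of x p]
    by (simp add: push_sym_sum[OF assms(2)] vf_push_at[OF diffeo])
  finally show "vf_push A (s x) (canonical_nabla X Y) q
      = canonical_nabla (vf_push A (s x) X) (vf_push A (s x) Y) q"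
    by (simp add: q canonical_nabla_def)
qed


subsection \<open>Parallelism of the symplectic form\<close>

lemma form: "is_form2 A \<omega>"
  using space by (simp add: symplectic_symmetric_space_def symplectic_form_def)

lemma form_lincomb_left:
  assumes "u \<in> tangent_space A p" "v \<in> tangent_space A p" "w \<in> tangent_space A p"
  shows "\<omega> p (\<lambda>c. a *\<^sub>R u c + b *\<^sub>R v c) w = a * \<omega> p u w + b * \<omega> p v w"
  using form[unfolded is_form2_def, THEN conjunct1] assms by simp

lemma form_antisym:
  assumes "u \<in> tangent_space A p" "v \<in> tangent_space A p"
  shows "\<omega> p u v = - \<omega> p v u"
  using form assms unfolding is_form2_def by blast

lemma form_coeff_smooth: "c \<in> A \<Longrightarrow> smooth_on (form2_coeff A \<omega> c u v) (cimg c)"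
  using form unfolding is_form2_def by blast

lemma form_sym_invariant:
  assumes "v \<in> tangent_space A p" "w \<in> tangent_space A p"
  shows "\<omega> (s x p) (differential A A (s x) p v) (differential A A (s x) p w) = \<omega> p v w"
  using space assms unfolding symplectic_symmetric_space_def symplectic_diffeomorphism_def by blast

lemma form_expand_left:
  assumes c: "c \<in> charts_at A p" and v: "v \<in> tangent_space A p" and w: "w \<in> tangent_space A p"
  shows "\<omega> p v w = (\<Sum>e\<in>B. (v c \<bullet> e) * \<omega> p (coord_vec A c p e) w)"
proof -
  note tan = coord_vec_tangent[OF atlas c]
  have lin: "coord_vec A c p (a *\<^sub>R x + b *\<^sub>R y)
      = (\<lambda>d. a *\<^sub>R coord_vec A c p x d + b *\<^sub>R coord_vec A c p y d)" for a b x y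
  proof
    fix d
    show "coord_vec A c p (a *\<^sub>R x + b *\<^sub>R y) d = a *\<^sub>R coord_vec A c p x d + b *\<^sub>R coord_vec A c p y d"
    proof (cases "d \<in> charts_at A p")
      case True
      interpret linear "chart_deriv c d id p"
        using True by (intro linear_chart_deriv[OF atlas atlas smooth_map_id[OF atlas] c]) simp
      show ?thesis using True by (simp add: coord_vec_chart add scale)
    qed (simp add: coord_vec_chart)
  qed
  have "linear (\<lambda>x. \<omega> p (coord_vec A c p x) w)"
  proof (rule linearI)
    show "\<omega> p (coord_vec A c p (x + y)) w = \<omega> p (coord_vec A c p x) w + \<omega> p (coord_vec A c p y) w" for x y
      using lin[of 1 x 1 y] form_lincomb_left[OF tan[of x] tan[of y] w, of 1 1] by simp
    show "\<omega> p (coord_vec A c p (r *\<^sub>R x)) w = r *\<^sub>R \<omega> p (coord_vec A c p x) w" for r x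
      using lin[of r x 0 x] form_lincomb_left[OF tan[of x] tan[of x] w, of r 0] by simp
  qed
  from linear_parseval_frame[OF frame this, of "v c"] show ?thesis
    by (simp add: coord_vec_tangent_space[OF v c])
qed

lemma form_expand:
  assumes c: "c \<in> charts_at A p" and v: "v \<in> tangent_space A p" and w: "w \<in> tangent_space A p"
  shows "\<omega> p v w = (\<Sum>e\<in>B. (v c \<bullet> e) * (\<Sum>e'\<in>B. (w c \<bullet> e') *
    \<omega> p (coord_vec A c p e) (coord_vec A c p e')))"
proof -
  note tan = coord_vec_tangent[OF atlas c]
  have "\<omega> p (coord_vec A c p e) w
      = (\<Sum>e'\<in>B. (w c \<bullet> e') * \<omega> p (coord_vec A c p e) (coord_vec A c p e'))" for e
    using form_expand_left[OF c w tan, of e]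
    by (simp add: form_antisym[OF tan w] form_antisym[OF tan tan, of e] sum_negf)
  then show ?thesis by (subst form_expand_left[OF c v w]) simp
qed

text \<open>
The coordinate expression of \<open>\<omega>(e, Z)\<close>, with \<open>e\<close> the constant coordinate field of the chart \<open>c\<close>.
\<close>

definition contracted_coeff :: "('m, 'e) chart \<Rightarrow> 'e \<Rightarrow> ('m, 'e) vfield \<Rightarrow> 'e \<Rightarrow> real" where
  "contracted_coeff c e Z y = (\<Sum>e'\<in>B. (Z (cinv c y) c \<bullet> e') * form2_coeff A \<omega> c e e' y)"

lemma contracted_coeff_smooth:
  assumes "Z \<in> vector_fields A" "c \<in> A"
  shows "smooth_on (contracted_coeff c e Z) (cimg c)"
proof -
  have "open (cimg c)" using assms(2) atlas by (intro open_cimg) (simp add: smooth_atlas_def)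
  then show ?thesis
    unfolding contracted_coeff_def[abs_def] using assms
    by (intro smooth_on_sum smooth_on_mult smooth_on_inner smooth_on_const form_coeff_smooth
        vector_fields_smooth)
qed

lemma form_fields_chart:
  assumes "Y \<in> vector_fields A" "Z \<in> vector_fields A" "c \<in> A" "y \<in> cimg c"
  shows "\<omega> (cinv c y) (Y (cinv c y)) (Z (cinv c y))
    = (\<Sum>e\<in>B. (Y (cinv c y) c \<bullet> e) * contracted_coeff c e Z y)"
proof -
  have ch: "is_chart c" using assms(3) atlas by (simp add: smooth_atlas_def)
  have "c \<in> charts_at A (cinv c y)" using assms cinv_cdom[OF ch] by (simp add: charts_at_def)
  from form_expand[OF this vector_fields_tangent[OF assms(1)] vector_fields_tangent[OF assms(2)]]
  show ?thesis by (simp add: contracted_coeff_def form2_coeff_def)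
qed

lemma form_fields_smooth:
  assumes "Y \<in> vector_fields A" "Z \<in> vector_fields A"
  shows "(\<lambda>q. \<omega> q (Y q) (Z q)) \<in> smooth_functions A"
proof (rule smooth_functionsI[OF atlas])
  fix c assume c: "c \<in> A"
  then have op: "open (cimg c)" using atlas by (intro open_cimg) (simp add: smooth_atlas_def)
  have "smooth_on (\<lambda>y. \<Sum>e\<in>B. (Y (cinv c y) c \<bullet> e) * contracted_coeff c e Z y) (cimg c)"
    by (intro smooth_on_sum smooth_on_mult smooth_on_inner smooth_on_const op
        contracted_coeff_smooth[OF assms(2) c] vector_fields_smooth[OF assms(1) c])
  then show "smooth_on ((\<lambda>q. \<omega> q (Y q) (Z q)) \<circ> cinv c) (cimg c)"
    by (rule smooth_on_cong[OF _ op]) (simp add: form_fields_chart[OF assms c])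
qed

text \<open>
In the product rule for \<open>\<omega>(W, Z)\<close> only the derivative of \<open>W\<close> survives at a zero of \<open>W\<close>.
\<close>

lemma form_zero_has_derivative:
  assumes "W \<in> vector_fields A" "Z \<in> vector_fields A" "W p = (\<lambda>c. 0)"
    and c: "c \<in> charts_at A p" and v: "v \<in> tangent_space A p"
  shows "frechet_derivative ((\<lambda>q. \<omega> q (W q) (Z q)) \<circ> cinv c) (at (cmap c p)) (v c)
    = \<omega> p (zero_deriv A W p v) (Z p)"
proof -
  note ch = smooth_atlas_chart[OF atlas c]
  have cA: "c \<in> A" "p \<in> cdom c" using c by (auto simp: charts_at_def)
  let ?D = "frechet_derivative (\<lambda>y. W (cinv c y) c) (at (cmap c p))"
  let ?G = "\<lambda>e. contracted_coeff c e Z"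
  have x: "cmap c p \<in> cimg c" using cA by simp
  have p: "cinv c (cmap c p) = p" by (rule cinv_cmap[OF ch cA(2)])
  have "((\<lambda>y. \<Sum>e\<in>B. (W (cinv c y) c \<bullet> e) * ?G e y) has_derivative
      (\<lambda>u. \<Sum>e\<in>B. (W (cinv c (cmap c p)) c \<bullet> e) * frechet_derivative (?G e) (at (cmap c p)) u
        + (?D u \<bullet> e) * ?G e (cmap c p))) (at (cmap c p))"
    by (intro has_derivative_sum has_derivative_mult has_derivative_inner_left
        vector_fields_has_derivative[OF assms(1) c]
        smooth_on_has_derivative[OF contracted_coeff_smooth[OF assms(2) cA(1)] x])
  then have "((\<lambda>y. \<Sum>e\<in>B. (W (cinv c y) c \<bullet> e) * ?G e y) has_derivative
      (\<lambda>u. \<Sum>e\<in>B. (?D u \<bullet> e) * ?G e (cmap c p))) (at (cmap c p))"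
    by (simp add: p assms(3))
  then have "((\<lambda>q. \<omega> q (W q) (Z q)) \<circ> cinv c has_derivative
      (\<lambda>u. \<Sum>e\<in>B. (?D u \<bullet> e) * ?G e (cmap c p))) (at (cmap c p))"
    by (rule has_derivative_transform_within_open[OF _ open_cimg[OF ch] x])
      (simp add: form_fields_chart[OF assms(1,2) cA(1)])
  from frechet_derivative_eqI[OF this] show ?thesis
    using form_expand[OF c zero_deriv_tangent[OF frame atlas assms(1,3) v] vector_fields_tangent[OF assms(2)]] c
    by (simp add: zero_deriv_def contracted_coeff_def form2_coeff_def p)
qed

text \<open>
The identity \<open>g - g \<circ> s\<^sub>p = \<omega>(Y + Y', Z) + \<omega>(Z + Z', Y')\<close> with \<open>g = \<omega>(Y, Z)\<close> has derivative \<open>2 d g(X)\<close>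
on the left, since \<open>s\<^sub>p\<close> has differential \<open>-1\<close>.  On the right the first entries vanish at \<open>p\<close>, so the
derivative involves only \<open>D\<^sub>X (Y + Y') = 2 \<nabla>\<^sub>X Y\<close> and \<open>D\<^sub>X (Z + Z') = 2 \<nabla>\<^sub>X Z\<close>.
\<close>

lemma canonical_nabla_form:
  assumes X: "X \<in> vector_fields A" and Y: "Y \<in> vector_fields A" and Z: "Z \<in> vector_fields A"
  shows "vf_deriv A X (\<lambda>q. \<omega> q (Y q) (Z q))
    p = \<omega> p (canonical_nabla X Y p) (Z p) + \<omega> p (Y p) (canonical_nabla X Z p)"
proof -
  obtain c where c: "c \<in> charts_at A p" using charts_at_nonempty[OF atlas] by blast
  note ch = smooth_atlas_chart[OF atlas c]
  have cA: "c \<in> A" "p \<in> cdom c" using c by (auto simp: charts_at_def)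
  note tX = vector_fields_tangent[OF X] and tY = vector_fields_tangent[OF Y]
    and tZ = vector_fields_tangent[OF Z]
  let ?Y' = "vf_push A (s p) Y" and ?Z' = "vf_push A (s p) Z"
  note Y' = push_closed[OF Y, of p] and Z' = push_closed[OF Z, of p]
  note tY' = vector_fields_tangent[OF Y'] and tZ' = vector_fields_tangent[OF Z']
  let ?f = "\<lambda>Y Z q. \<omega> q (Y q) (Z q)" and ?x = "cmap c p" and ?u = "X p c"
  let ?D = "\<lambda>g. frechet_derivative (g \<circ> cinv c) (at ?x)"
  have der: "(g \<circ> cinv c has_derivative ?D g) (at ?x)" if "g \<in> smooth_functions A" for g
    using cA by (intro smooth_on_has_derivative[OF smooth_functionsD[OF atlas that]]) auto
  let ?g = "?f Y Z"
  note sg = form_fields_smooth[OF Y Z]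
  interpret dg: linear "?D ?g" by (rule has_derivative_linear[OF der[OF sg]])
  have refl: "(?g \<circ> s p \<circ> cinv c has_derivative (\<lambda>u. - ?D ?g u)) (at ?x)"
    using function_compose_has_derivative[OF atlas sg smooth_sym c, of c p] c
    by (simp add: fixed chart_deriv_sym dg.neg)
  have inv: "(?g \<circ> s p) q = ?f ?Y' ?Z' q" for q
    using form_sym_invariant[OF tY tZ, of p "s p q"] vf_push_at[OF diffeo, of p _ "s p q"]
    by (simp add: invol)
  have split: "?g q - (?g \<circ> s p) q = ?f (sym_sum p Y) Z q + ?f (sym_sum p Z) ?Y' q" for q
    using form_lincomb_left[OF tY[of q] tY' tZ, of 1 1] form_lincomb_left[OF tZ[of q] tZ' tY', of 1 1]
      form_antisym[OF tZ'[of q] tY'] form_antisym[OF tZ[of q] tY']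
    unfolding inv by (simp add: sym_sum_def vf_add_def)
  have fn: "(\<lambda>y. (?g \<circ> cinv c) y - (?g \<circ> s p \<circ> cinv c) y)
      = (\<lambda>y. (?f (sym_sum p Y) Z \<circ> cinv c) y + (?f (sym_sum p Z) ?Y' \<circ> cinv c) y)"
    using split by (simp add: fun_eq_iff)
  have "((\<lambda>y. (?g \<circ> cinv c) y - (?g \<circ> s p \<circ> cinv c) y) has_derivative
      (\<lambda>u. ?D ?g u - (- ?D ?g u))) (at ?x)"
    by (intro has_derivative_diff der[OF sg] refl)
  moreover have "((\<lambda>y. (?g \<circ> cinv c) y - (?g \<circ> s p \<circ> cinv c) y) has_derivative
      (\<lambda>u. ?D (?f (sym_sum p Y) Z) u + ?D (?f (sym_sum p Z) ?Y') u)) (at ?x)"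
    unfolding fn
    by (intro has_derivative_add der form_fields_smooth sym_sum_closed Y Z Y')
  ultimately have "(\<lambda>u. ?D ?g u - (- ?D ?g u))
      = (\<lambda>u. ?D (?f (sym_sum p Y) Z) u + ?D (?f (sym_sum p Z) ?Y') u)"
    by (rule has_derivative_unique)
  from fun_cong[OF this, of ?u] have "2 * ?D ?g ?u = ?D (?f (sym_sum p Y) Z) ?u + ?D (?f (sym_sum p Z) ?Y') ?u"
    by simp
  also have "\<dots> = \<omega> p (zero_deriv A (sym_sum p Y) p (X p)) (Z p)
      + \<omega> p (zero_deriv A (sym_sum p Z) p (X p)) (?Y' p)"
    by (simp only: form_zero_has_derivative[OF sym_sum_closed[OF Y] Z sym_sum_zero[OF Y] c tX]
        form_zero_has_derivative[OF sym_sum_closed[OF Z] Y' sym_sum_zero[OF Z] c tX])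
  also have "\<omega> p (zero_deriv A (sym_sum p Z) p (X p)) (?Y' p)
      = \<omega> p (Y p) (zero_deriv A (sym_sum p Z) p (X p))"
    using form_antisym[OF tY'[of p] zero_deriv_sym_sum_tangent[OF X Z]]
      form_lincomb_left[OF tY[of p] tY zero_deriv_sym_sum_tangent[OF X Z], of "- 1" 0]
    by (simp add: push_at_center[OF Y])
  finally have "2 * ?D ?g ?u = \<omega> p (zero_deriv A (sym_sum p Y) p (X p)) (Z p)
      + \<omega> p (Y p) (zero_deriv A (sym_sum p Z) p (X p))" .
  moreover have "vf_deriv A X ?g p = ?D ?g ?u"
    by (rule vf_deriv_chart[where X = X and p = p, OF atlas sg tX c])
  moreover have "\<omega> p (canonical_nabla X Y p) (Z p)
      = 1/2 * \<omega> p (zero_deriv A (sym_sum p Y) p (X p)) (Z p)"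
    using form_lincomb_left[OF zero_deriv_sym_sum_tangent[OF X Y, of p]
        zero_deriv_sym_sum_tangent[OF X Y] tZ, of "1/2" 0]
    by (simp add: canonical_nabla_def)
  moreover have "\<omega> p (Y p) (canonical_nabla X Z p)
      = 1/2 * \<omega> p (Y p) (zero_deriv A (sym_sum p Z) p (X p))"
    using form_lincomb_left[OF zero_deriv_sym_sum_tangent[OF X Z, of p]
        zero_deriv_sym_sum_tangent[OF X Z] tY, of "1/2" 0]
      form_antisym[OF tY[of p] canonical_nabla_tangent[OF X Z]]
      form_antisym[OF tY[of p] zero_deriv_sym_sum_tangent[OF X Z]]
    by (simp add: canonical_nabla_def)
  ultimately show ?thesis by simp
qed

lemma canonical_nabla_admissible:
  "admissible A \<omega> s (restrict (\<lambda>(X, Y). canonical_nabla X Y) (vector_fields A \<times> vector_fields A))"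
proof -
  let ?n = "restrict (\<lambda>(X, Y). canonical_nabla X Y) (vector_fields A \<times> vector_fields A)"
  have "covariant_derivative A ?n"
    by (rule covariant_derivativeI)
      (auto simp: atlas canonical_nabla_closed canonical_nabla_add_left canonical_nabla_add_right
        canonical_nabla_scale_left canonical_nabla_Leibniz)
  moreover have "nabla_form2 A ?n \<omega> X Y Z p = 0"
    if "X \<in> vector_fields A" "Y \<in> vector_fields A" "Z \<in> vector_fields A" for X Y Z p
    using that canonical_nabla_form[OF that] by (simp add: nabla_form2_def)
  moreover have "affine_transformation A ?n (s x)" for x
    unfolding affine_transformation_def using diffeo by (simp add: canonical_nabla_affine push_closed)
  ultimately show ?thesis by (simp add: admissible_def)
qed

end

section \<open>Tensoriality and uniqueness\<close>

lemma smooth_extension_by_zero: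
  fixes f :: "'m::topological_space \<Rightarrow> 'b::real_normed_vector"
    and A :: "('m, 'e::real_normed_vector) chart set"
  assumes "smooth_atlas A" "c \<in> A" "d \<in> A" "closed K" "K \<subseteq> cdom c" "\<And>q. q \<notin> K \<Longrightarrow> f q = 0"
    and "smooth_on (f \<circ> cinv d) (cmap d ` (cdom d \<inter> cdom c))"
  shows "smooth_on (f \<circ> cinv d) (cimg d)"
proof (rule smooth_on_local)
  have ch: "is_chart c" "is_chart d" using assms(1-3) by (auto simp: smooth_atlas_def)
  fix y assume "y \<in> cimg d"
  then obtain q where q: "q \<in> cdom d" "y = cmap d q" by blast
  show "\<exists>T. open T \<and> y \<in> T \<and> smooth_on (f \<circ> cinv d) T"
  proof (cases "q \<in> cdom c")
    case True
    then show ?thesis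
      using assms(7) open_cmap_image[OF ch(2) open_cdom[OF ch(1)]] q by blast
  next
    case False
    let ?T = "cmap d ` (cdom d \<inter> - K)"
    have T: "open ?T" using assms(4) by (intro open_cmap_image[OF ch(2)]) auto
    have "smooth_on (f \<circ> cinv d) ?T"
    proof (rule smooth_on_cong[OF smooth_on_const T])
      fix z assume "z \<in> ?T"
      then show "0 = (f \<circ> cinv d) z" using assms(6) cinv_cmap[OF ch(2)] by auto
    qed
    then show ?thesis using T False q assms(5) by blast
  qed
qed

text \<open>
Transport a bump function supported in a closed ball inside the chart.  The ball is compact, hence its
preimage \<open>K\<close> is closed in the Hausdorff space \<open>M\<close>, which makes the extension by zero smooth.
\<close>

lemma manifold_bump_exists:
  fixes A :: "('m::t2_space, 'e::real_inner) chart set" and B :: "'e set"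
  assumes "parseval_frame B" "smooth_atlas A" "c \<in> charts_at A p"
  obtains \<phi> K where "\<phi> \<in> smooth_functions A" "\<phi> p \<noteq> 0" "closed K" "K \<subseteq> cdom c"
    "\<And>q. q \<notin> K \<Longrightarrow> \<phi> q = 0"
proof -
  note ch = smooth_atlas_chart[OF assms(2,3)]
  have cA: "c \<in> A" "p \<in> cdom c" using assms(3) by (auto simp: charts_at_def)
  obtain r where r: "r > 0" "cball (cmap c p) r \<subseteq> cimg c"
    using open_contains_cball[THEN iffD1, rule_format, OF open_cimg[OF ch], of "cmap c p"] cA by auto
  obtain \<psi> :: "'e \<Rightarrow> real" where \<psi>: "smooth_on \<psi> UNIV" "\<psi> (cmap c p) \<noteq> 0"
    "\<And>y. y \<notin> cball (cmap c p) r \<Longrightarrow> \<psi> y = 0"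
    using smooth_bump_exists[OF r(1)] by blast
  define K where "K = cinv c ` cball (cmap c p) r"
  define \<phi> where "\<phi> q = (if q \<in> cdom c then \<psi> (cmap c q) else 0)" for q
  have "compact K"
    unfolding K_def
    by (intro compact_continuous_image compact_cball_parseval_frame[OF assms(1)]
        continuous_on_subset[OF continuous_on_cinv[OF ch] r(2)])
  then have K: "closed K" by (rule compact_imp_closed)
  have sub: "K \<subseteq> cdom c" using r(2) cinv_cdom[OF ch] unfolding K_def by blast
  have zero: "\<phi> q = 0" if "q \<notin> K" for q
  proof (cases "q \<in> cdom c")
    case True
    then have "cmap c q \<notin> cball (cmap c p) r" using that cinv_cmap[OF ch True] unfolding K_def by force
    then show ?thesis using \<psi>(3) by (simp add: \<phi>_def)
  qed (simp add: \<phi>_def)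
  have "\<phi> \<in> smooth_functions A"
  proof (rule smooth_functionsI[OF assms(2)])
    fix d assume d: "d \<in> A"
    then have dh: "is_chart d" using assms(2) by (simp add: smooth_atlas_def)
    note tr = smooth_map_local[OF assms(2,2) smooth_map_id[OF assms(2)] d cA(1)]
    have "smooth_on (\<lambda>y. \<psi> ((cmap c \<circ> id \<circ> cinv d) y)) (cmap d ` (cdom d \<inter> id -` cdom c))"
      by (rule smooth_on_compose[OF assms(1) \<psi>(1) tr]) simp
    then have "smooth_on (\<phi> \<circ> cinv d) (cmap d ` (cdom d \<inter> id -` cdom c))"
      by (rule smooth_on_cong[OF _ tr(2)]) (auto simp: \<phi>_def cinv_cmap[OF dh])
    then show "smooth_on (\<phi> \<circ> cinv d) (cimg d)"
      by (intro smooth_extension_by_zero[OF assms(2) cA(1) d K sub zero]) (simp_all add: id_def)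
  qed
  moreover have "\<phi> p \<noteq> 0" using \<psi>(2) cA by (simp add: \<phi>_def)
  ultimately show ?thesis using that K sub zero by blast
qed

lemma zero_field: "smooth_atlas A \<Longrightarrow> (\<lambda>q d. 0) \<in> vector_fields A"
proof (rule vector_fieldsI)
  fix q assume A: "smooth_atlas A"
  then obtain d where "d \<in> charts_at A q" using charts_at_nonempty by blast
  from tangent_space_scale[OF A coord_vec_tangent[OF A this], of 0 0]
  show "(\<lambda>d. 0) \<in> tangent_space A q" by simp
qed (rule smooth_on_const)

lemma smooth_function_const: "smooth_atlas A \<Longrightarrow> (\<lambda>q. t) \<in> smooth_functions A"
  by (rule smooth_functionsI) (simp_all add: comp_def smooth_on_const)

lemma smooth_function_mult:
  assumes "smooth_atlas A" "f \<in> smooth_functions A" "g \<in> smooth_functions A"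
  shows "(\<lambda>q. f q * g q) \<in> smooth_functions A"
proof (rule smooth_functionsI[OF assms(1)])
  fix c assume c: "c \<in> A"
  then have "open (cimg c)" using assms(1) by (intro open_cimg) (simp add: smooth_atlas_def)
  from smooth_on_mult[OF smooth_functionsD[OF assms(1,2) c] smooth_functionsD[OF assms(1,3) c] this]
  show "smooth_on ((\<lambda>q. f q * g q) \<circ> cinv c) (cimg c)" by (simp add: comp_def)
qed

lemma cutoff_component_smooth:
  fixes A :: "('m::topological_space, 'e::real_inner) chart set" and B :: "'e set"
  assumes "parseval_frame B" "smooth_atlas A" "c \<in> A" "\<phi> \<in> smooth_functions A" "V \<in> vector_fields A"
    and "closed K" "K \<subseteq> cdom c" "\<And>q. q \<notin> K \<Longrightarrow> \<phi> q = 0"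
  shows "(\<lambda>q. \<phi> q * (V q c \<bullet> e)) \<in> smooth_functions A"
proof (rule smooth_functionsI[OF assms(2)])
  fix d assume d: "d \<in> A"
  have dh: "is_chart d" and ch: "is_chart c" using assms(2,3) d by (auto simp: smooth_atlas_def)
  let ?\<tau> = "cmap c \<circ> id \<circ> cinv d" and ?T = "cmap d ` (cdom d \<inter> id -` cdom c)"
  note tr = smooth_map_local[OF assms(2,2) smooth_map_id[OF assms(2)] d assms(3)]
  have "smooth_on (\<lambda>y. V (cinv c (?\<tau> y)) c) ?T"
    by (rule smooth_on_compose[OF assms(1) vector_fields_smooth[OF assms(5,3)] tr])
      (auto simp: cinv_cmap[OF dh])
  then have "smooth_on (\<lambda>y. (\<phi> \<circ> cinv d) y * (V (cinv c (?\<tau> y)) c \<bullet> e)) ?T"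
    by (intro smooth_on_mult smooth_on_inner smooth_on_const tr(2)
        smooth_on_subset[OF smooth_functionsD[OF assms(2,4) d]]) auto
  then have "smooth_on ((\<lambda>q. \<phi> q * (V q c \<bullet> e)) \<circ> cinv d) ?T"
    by (rule smooth_on_cong[OF _ tr(2)]) (auto simp: cinv_cmap[OF dh] cinv_cmap[OF ch])
  then show "smooth_on ((\<lambda>q. \<phi> q * (V q c \<bullet> e)) \<circ> cinv d) (cimg d)"
    by (intro smooth_extension_by_zero[OF assms(2,3) d assms(6,7)]) (simp_all add: assms(8) id_def)
qed

lemma cutoff_coord_field:
  fixes A :: "('m::topological_space, 'e::real_inner) chart set" and B :: "'e set"
  assumes "parseval_frame B" "smooth_atlas A" "c \<in> A" "\<phi> \<in> smooth_functions A"
    and "closed K" "K \<subseteq> cdom c" "\<And>q. q \<notin> K \<Longrightarrow> \<phi> q = 0"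
  shows "vf_scale \<phi> (\<lambda>q. coord_vec A c q e) \<in> vector_fields A"
  unfolding vf_scale_def
proof (rule vector_fieldsI)
  fix q
  show "(\<lambda>d. \<phi> q *\<^sub>R coord_vec A c q e d) \<in> tangent_space A q"
  proof (cases "q \<in> K")
    case True
    then have "c \<in> charts_at A q" using assms(3,6) by (auto simp: charts_at_def)
    then show ?thesis by (intro tangent_space_scale coord_vec_tangent assms(2))
  next
    case False
    then show ?thesis using vector_fields_tangent[OF zero_field[OF assms(2)], of q] assms(7) by simp
  qed
next
  fix d assume d: "d \<in> A"
  have dh: "is_chart d" and ch: "is_chart c" using assms(2,3) d by (auto simp: smooth_atlas_def)
  let ?\<tau> = "cmap c \<circ> id \<circ> cinv d" and ?T = "cmap d ` (cdom d \<inter> id -` cdom c)"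
  let ?f = "\<lambda>q. \<phi> q *\<^sub>R coord_vec A c q e d"
  note tr = smooth_map_local[OF assms(2,2) smooth_map_id[OF assms(2)] d assms(3)]
    and tr' = smooth_map_local[OF assms(2,2) smooth_map_id[OF assms(2)] assms(3) d]
  have "?\<tau> ` ?T \<subseteq> cmap c ` (cdom c \<inter> id -` cdom d)" by (auto simp: cinv_cmap[OF dh])
  then have "smooth_on (\<lambda>y. (\<phi> \<circ> cinv d) y *\<^sub>R
      frechet_derivative (cmap d \<circ> id \<circ> cinv c) (at (?\<tau> y)) e) ?T"
    by (intro smooth_on_scaleR tr(2)
        smooth_on_frechet_along[OF assms(1) tr'(1) tr(1) smooth_on_const tr(2)]
        smooth_on_subset[OF smooth_functionsD[OF assms(2,4) d]]) auto
  then have "smooth_on (?f \<circ> cinv d) ?T"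
    by (rule smooth_on_cong[OF _ tr(2)])
      (auto simp: cinv_cmap[OF dh] coord_vec_chart charts_at_def d assms(3) chart_deriv_def)
  then have "smooth_on (?f \<circ> cinv d) (cimg d)"
    by (intro smooth_extension_by_zero[OF assms(2,3) d assms(5,6)]) (simp_all add: assms(7) id_def)
  then show "smooth_on (\<lambda>y. \<phi> (cinv d y) *\<^sub>R coord_vec A c (cinv d y) e d) (cimg d)"
    by (simp add: comp_def)
qed

text \<open>
Let \<open>\<phi>\<close> be a cut-off function supported in a chart, and \<open>v\<^sub>e\<close> the coordinates of \<open>V\<close>.  Then
\<open>\<phi>\<^sup>2 V = \<Sum>\<^sub>e (\<phi> v\<^sub>e) (\<phi> e)\<close> is an identity between global objects; as \<open>v\<^sub>e(p) = 0\<close>, linearity gives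
\<open>\<phi>(p)\<^sup>2 F V = 0\<close>.
\<close>

lemma tensorial_vanishes:
  fixes A :: "('m::t2_space, 'e::real_inner) chart set" and B :: "'e set"
    and F :: "('m, 'e) vfield \<Rightarrow> ('m, 'e) tvec"
  assumes "parseval_frame B" "smooth_atlas A"
    and add: "\<And>X Y. X \<in> vector_fields A \<Longrightarrow> Y \<in> vector_fields A \<Longrightarrow>
      F (vf_add X Y) = (\<lambda>c. F X c + F Y c)"
    and scale: "\<And>f X. f \<in> smooth_functions A \<Longrightarrow> X \<in> vector_fields A \<Longrightarrow>
      F (vf_scale f X) = (\<lambda>c. f p *\<^sub>R F X c)"
    and V: "V \<in> vector_fields A" "V p = (\<lambda>c. 0)"
  shows "F V = (\<lambda>c. 0)"
proof -
  obtain c where c: "c \<in> charts_at A p" using charts_at_nonempty[OF assms(2)] by blast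
  have cA: "c \<in> A" using c by (simp add: charts_at_def)
  obtain \<phi> K where \<phi>: "\<phi> \<in> smooth_functions A" "\<phi> p \<noteq> 0" "closed K" "K \<subseteq> cdom c"
    "\<And>q. q \<notin> K \<Longrightarrow> \<phi> q = 0"
    by (rule manifold_bump_exists[OF assms(1,2) c]) blast
  define g where "g e q = \<phi> q * (V q c \<bullet> e)" for e q
  define E where "E e = vf_scale \<phi> (\<lambda>q. coord_vec A c q e)" for e
  have g: "g e \<in> smooth_functions A" for e
    unfolding g_def by (rule cutoff_component_smooth[OF assms(1,2) cA \<phi>(1) V(1) \<phi>(3-5)])
  have E: "E e \<in> vector_fields A" for e
    unfolding E_def by (rule cutoff_coord_field[OF assms(1,2) cA \<phi>(1) \<phi>(3-5)])
  have zero: "F (\<lambda>q d. 0) = (\<lambda>d. 0)"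
    using scale[OF smooth_function_const[OF assms(2), of 0] V(1)] by (simp add: vf_scale_def)
  have sum: "(\<lambda>q d. \<Sum>e\<in>S. vf_scale (g e) (E e) q d) \<in> vector_fields A \<and>
      F (\<lambda>q d. \<Sum>e\<in>S. vf_scale (g e) (E e) q d) = (\<lambda>d. 0)" if "finite S" for S
    using that
  proof induction
    case empty
    then show ?case by (simp add: zero zero_field[OF assms(2)])
  next
    case (insert e S)
    have ge: "vf_scale (g e) (E e) \<in> vector_fields A" by (rule vf_scale_closed[OF assms(2) g E])
    have "F (vf_scale (g e) (E e)) = (\<lambda>d. 0)" using scale[OF g E] V(2) by (simp add: g_def)
    moreover have "(\<lambda>q d. \<Sum>e\<in>insert e S. vf_scale (g e) (E e) q d)
        = vf_add (vf_scale (g e) (E e)) (\<lambda>q d. \<Sum>e\<in>S. vf_scale (g e) (E e) q d)"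
      using insert by (simp add: vf_add_def)
    ultimately show ?case
      using insert.IH add[OF ge] vf_add_closed[OF assms(2) ge] by simp
  qed
  have "vf_scale (\<lambda>q. \<phi> q * \<phi> q) V = (\<lambda>q d. \<Sum>e\<in>B. vf_scale (g e) (E e) q d)"
  proof (intro ext)
    fix q d
    show "vf_scale (\<lambda>q. \<phi> q * \<phi> q) V q d = (\<Sum>e\<in>B. vf_scale (g e) (E e) q d)"
    proof (cases "q \<in> K \<and> d \<in> charts_at A q")
      case True
      then have cq: "c \<in> charts_at A q" using \<phi>(4) cA by (auto simp: charts_at_def)
      have "V q d = chart_deriv c d id q (V q c)"
        using True by (intro tangent_space_chart[OF vector_fields_tangent[OF V(1)] cq]) simp
      also have "\<dots> = (\<Sum>e\<in>B. (V q c \<bullet> e) *\<^sub>R chart_deriv c d id q e)"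
        using True by (intro linear_parseval_frame[OF assms(1)]
            linear_chart_deriv[OF assms(2,2) smooth_map_id[OF assms(2)] cq]) simp
      finally show ?thesis
        using True by (simp add: vf_scale_def g_def E_def coord_vec_chart scaleR_sum_right mult_ac)
    next
      case False
      then show ?thesis
        using \<phi>(5)[of q] tangent_space_0[OF vector_fields_tangent[OF V(1)], of d q]
        by (auto simp: vf_scale_def g_def E_def coord_vec_chart)
    qed
  qed
  then have "F (vf_scale (\<lambda>q. \<phi> q * \<phi> q) V) = (\<lambda>d. 0)"
    using sum[of B] assms(1) by (simp add: parseval_frame_def)
  then show ?thesis
    using scale[OF smooth_function_mult[OF assms(2) \<phi>(1,1)] V(1)] \<phi>(2) by (simp add: fun_eq_iff)
qed

context symmetric_space
begin

lemma covariant_derivative_vanishes_left: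
  assumes "covariant_derivative A n" "V \<in> vector_fields A" "Y \<in> vector_fields A" "V p = (\<lambda>c. 0)"
  shows "n (V, Y) p = (\<lambda>c. 0)"
  using assms unfolding covariant_derivative_def
  by (intro tensorial_vanishes[OF frame atlas, where F = "\<lambda>V. n (V, Y) p" and p = p])
     (auto simp: vf_add_def vf_scale_def)

text \<open>
The Leibniz terms cancel, so the difference of two covariant derivatives is linear over functions in
its second argument as well.
\<close>

lemma covariant_derivative_agree_at_zero:
  assumes n1: "covariant_derivative A n1" and n2: "covariant_derivative A n2"
    and X: "X \<in> vector_fields A" and W: "W \<in> vector_fields A" "W p = (\<lambda>c. 0)"
  shows "n1 (X, W) p = n2 (X, W) p"
proof -
  have "(\<lambda>c. n1 (X, W) p c - n2 (X, W) p c) = (\<lambda>c. 0)"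
  proof (rule tensorial_vanishes[OF frame atlas, where F = "\<lambda>W c. n1 (X, W) p c - n2 (X, W) p c"
        and p = p])
    fix Y Z assume "Y \<in> vector_fields A" "Z \<in> vector_fields A"
    then have "n1 (X, vf_add Y Z) = vf_add (n1 (X, Y)) (n1 (X, Z))"
      "n2 (X, vf_add Y Z) = vf_add (n2 (X, Y)) (n2 (X, Z))"
      using n1 n2 X unfolding covariant_derivative_def by blast+
    then show "(\<lambda>c. n1 (X, vf_add Y Z) p c - n2 (X, vf_add Y Z) p c) =
        (\<lambda>c. n1 (X, Y) p c - n2 (X, Y) p c + (n1 (X, Z) p c - n2 (X, Z) p c))"
      by (simp add: vf_add_def algebra_simps)
  next
    fix f Y assume "f \<in> smooth_functions A" "Y \<in> vector_fields A"
    then have "n1 (X, vf_scale f Y) = vf_add (vf_scale (vf_deriv A X f) Y) (vf_scale f (n1 (X, Y)))"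
      "n2 (X, vf_scale f Y) = vf_add (vf_scale (vf_deriv A X f) Y) (vf_scale f (n2 (X, Y)))"
      using n1 n2 X unfolding covariant_derivative_def by blast+
    then show "(\<lambda>c. n1 (X, vf_scale f Y) p c - n2 (X, vf_scale f Y) p c) =
        (\<lambda>c. f p *\<^sub>R (n1 (X, Y) p c - n2 (X, Y) p c))"
      by (simp add: vf_add_def vf_scale_def scaleR_diff_right)
  qed (fact W)+
  then show ?thesis by (simp add: fun_eq_iff)
qed

text \<open>
At \<open>p\<close> the field \<open>X\<close> may be replaced by \<open>- (s\<^sub>p)\<^sub>* X\<close>, because \<open>X + (s\<^sub>p)\<^sub>* X\<close> vanishes there.  Together
with the invariance under \<open>s\<^sub>p\<close> this yields \<open>\<nabla>\<^sub>X ((s\<^sub>p)\<^sub>* Y) = \<nabla>\<^sub>X Y\<close> at \<open>p\<close>.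
\<close>

lemma admissible_sym_sum:
  assumes n: "admissible A \<omega> s n" and X: "X \<in> vector_fields A" and Y: "Y \<in> vector_fields A"
  shows "n (X, sym_sum p Y) p = (\<lambda>c. 2 *\<^sub>R n (X, Y) p c)"
proof -
  have cd: "covariant_derivative A n" using n by (simp add: admissible_def)
  then have closed: "n (X, Y) \<in> vector_fields A"
    using X Y unfolding covariant_derivative_def by blast
  let ?X' = "vf_push A (s p) X" and ?Y' = "vf_push A (s p) Y"
  note X' = push_closed[OF X, of p] and Y' = push_closed[OF Y, of p]
  have "vf_push A (s p) (n (X, Y)) = n (?X', ?Y')"
    using n X Y by (simp add: admissible_def affine_transformation_def)
  then have 1: "n (?X', ?Y') p = (\<lambda>c. - n (X, Y) p c)" using push_at_center[OF closed, of p] by simp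
  have "n (vf_add X ?X', ?Y') = vf_add (n (X, ?Y')) (n (?X', ?Y'))"
    and sum: "n (X, vf_add Y ?Y') = vf_add (n (X, Y)) (n (X, ?Y'))"
    using cd X X' Y Y' unfolding covariant_derivative_def by blast+
  moreover have "n (vf_add X ?X', ?Y') p = (\<lambda>c. 0)"
    using covariant_derivative_vanishes_left[OF cd sym_sum_closed[OF X] Y' sym_sum_zero[OF X]]
    by (simp add: sym_sum_def)
  ultimately have "n (X, ?Y') p = n (X, Y) p" by (simp add: vf_add_def 1 fun_eq_iff)
  then show ?thesis unfolding sym_sum_def sum by (simp add: vf_add_def scaleR_2)
qed

lemma admissible_unique:
  assumes n1: "admissible A \<omega> s n1" and n2: "admissible A \<omega> s n2"
  shows "n1 = n2"
proof (rule PiE_ext)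
  have cd: "covariant_derivative A n1" "covariant_derivative A n2"
    using n1 n2 by (auto simp: admissible_def)
  then show "n1 \<in> (vector_fields A \<times> vector_fields A) \<rightarrow>\<^sub>E vector_fields A"
    "n2 \<in> (vector_fields A \<times> vector_fields A) \<rightarrow>\<^sub>E vector_fields A"
    by (simp_all add: covariant_derivative_def)
  fix z assume "z \<in> vector_fields A \<times> vector_fields A"
  then obtain X Y where z: "z = (X, Y)" and X: "X \<in> vector_fields A" and Y: "Y \<in> vector_fields A" by blast
  show "n1 z = n2 z"
  proof (intro ext)
    fix p c
    have "n1 (X, sym_sum p Y) p = n2 (X, sym_sum p Y) p"
      by (rule covariant_derivative_agree_at_zero[OF cd X sym_sum_closed[OF Y] sym_sum_zero[OF Y]])
    then show "n1 z p c = n2 z p c"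
      by (cases c) (simp add: z admissible_sym_sum[OF n1 X Y] admissible_sym_sum[OF n2 X Y] fun_eq_iff)
  qed
qed

end

theorem theorem1p4:
  fixes A :: "('m::{t2_space,second_countable_topology}, 'e::{real_inner,banach}) chart set"
    and \<omega> :: "('m, 'e) form2"
    and s :: "'m \<Rightarrow> 'm \<Rightarrow> 'm"
  assumes "symplectic_symmetric_space A \<omega> s"
  shows "\<exists>!nabla. admissible A \<omega> s nabla"
proof -
  obtain C :: "'e set" where "finite C" "span C = UNIV"
    using assms unfolding symplectic_symmetric_space_def connected_manifold_def by blast
  then obtain B :: "'e set" where "parseval_frame B" using parseval_frame_exists by blast
  then interpret symmetric_space A \<omega> s B using assms by unfold_locales
  show ?thesis
  proof (rule ex1I)
    show "nabla = restrict (\<lambda>(X, Y). canonical_nabla X Y) (vector_fields A \<times> vector_fields A)"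
      if "admissible A \<omega> s nabla" for nabla
      by (rule admissible_unique[OF that canonical_nabla_admissible])
  qed (rule canonical_nabla_admissible)
qed

end
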